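(* There is a universal constant $A>0$ such that for all integers $m\ge \ell\ge 8$ and all integers $k$ with $2\le k\le \ell m/2$, $$ p_k(\ell,m)-p_{k-1}(\ell,m)\ >\ A\,\frac{2^{\sqrt{s}}}{s^{9/4}},\qquad\text{where } s=\min\{2k,\ell^2\}. $$
   Context: The numbers $p_n(\ell,m)$ are the coefficients of the $q$-binomial (Gaussian) coefficient: $$\binom{m+\ell}{m}_q=\frac{(q^{m+1}-1)\cdots(q^{m+\ell}-1)}{(q-1)\cdots(q^\ell-1)}=\sum_{n=0}^{\ell m} p_n(\ell,m)\,q^n;$$ equivalently $p_n(\ell,m)$ is the number of partitions of $n$ whose Young diagram fits inside an $\ell\times m$ rectangle. *)

theory Defs
  imports Complex_Main "HOL-Computational_Algebra.Polynomial"
begin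

(* The Gaussian coefficient (m + l choose m)_q as a polynomial in q with integer coefficients;
   q_binomial_exact below shows that the polynomial division is exact. *)
definition q_binomial :: "nat \<Rightarrow> nat \<Rightarrow> int poly" where
  "q_binomial l m = (\<Prod>i=1..l. monom 1 (m + i) - 1) div (\<Prod>i=1..l. monom 1 i - 1)"

definition qbin_coeff :: "nat \<Rightarrow> nat \<Rightarrow> nat \<Rightarrow> int" where
  "qbin_coeff n l m = coeff (q_binomial l m) n"

lemma q_binomial_dvd:
  "(\<Prod>i=1..l. monom 1 i - 1 :: int poly) dvd (\<Prod>i=1..l. monom 1 (m + i) - 1)"
proof (induction "l + m" arbitrary: l m rule: less_induct)
  case less
  show ?case
  proof (cases "l = 0 \<or> m = 0")
    case True
    then show ?thesis by auto
  next
    case False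
    then obtain a b where [simp]: "l = Suc a" "m = Suc b"
      by (metis not0_implies_Suc)
    define N where "N = (\<lambda>l m. \<Prod>i=1..l. monom 1 (m + i) - 1 :: int poly)"
    define D where "D = (\<lambda>l. \<Prod>i=1..l. monom 1 i - 1 :: int poly)"
    have "monom 1 (Suc b + Suc a) - 1 =
        (monom 1 (Suc a) - 1) * monom 1 (Suc b) + (monom 1 (Suc b) - 1 :: int poly)"
      by (simp add: algebra_simps mult_monom)
    then have N1: "N l m =
        N a m * (monom 1 (Suc a) - 1) * monom 1 (Suc b) + N a m * (monom 1 (Suc b) - 1)"
      unfolding N_def by (simp add: algebra_simps)
    have N2: "N a m * (monom 1 (Suc b) - 1) = N l b"
    proof -
      have "N l b = (\<Prod>i\<in>{0..a}. monom 1 (b + Suc i) - 1)"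
        unfolding N_def using prod.shift_bounds_cl_Suc_ivl[of "\<lambda>i. monom 1 (b + i) - 1" 0 a]
        by simp
      also have "\<dots> = (monom 1 (Suc b) - 1) * N a m"
        unfolding N_def by (simp add: prod.atLeast_Suc_atMost)
      finally show ?thesis by (simp add: mult.commute)
    qed
    have "D a dvd N a m" "D l dvd N l b"
      unfolding D_def N_def by (rule less; simp)+
    moreover have "D l = D a * (monom 1 (Suc a) - 1)"
      unfolding D_def by simp
    ultimately have "D l dvd N a m * (monom 1 (Suc a) - 1)" "D l dvd N l b"
      by (simp_all only: mult_dvd_mono dvd_refl)
    then have "D l dvd N l m"
      unfolding N1 N2 by (rule dvd_add[OF dvd_mult2])
    then show ?thesis unfolding D_def N_def .
  qed
qed

lemma q_binomial_exact:
  "q_binomial l m * (\<Prod>i=1..l. monom 1 i - 1) = (\<Prod>i=1..l. monom 1 (m + i) - 1)"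
  unfolding q_binomial_def by (rule dvd_div_mult_self[OF q_binomial_dvd])

end

theory Submission
  imports Defs "HOL-Library.Poly_Mapping" "HOL-Analysis.Complex_Transcendental"
    "HOL-Analysis.Henstock_Kurzweil_Integration" "HOL-Real_Asymp.Real_Asymp"
begin

text \<open>
  Write \<open>\<delta>\<^sub>k(l, m) = p\<^sub>k(l, m) - p\<^sub>k\<^sub>-\<^sub>1(l, m)\<close>. For \<open>2 k \<le> l m\<close> this is the dimension of the space of
  highest weight vectors of degree \<open>l\<close> and weight \<open>k\<close> in the polynomial ring on the irreducible
  representation of \<open>sl\<^sub>2\<close> of dimension \<open>m + 1\<close>. That ring is a domain, so multiplication by a nonzero
  highest weight vector is injective: \<open>\<delta>\<^sub>k(l, m) \<le> \<delta>\<^sub>k\<^sub>+\<^sub>j(l + l', m)\<close> whenever \<open>\<delta>\<^sub>j(l', m) > 0\<close>, and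
  the roles of \<open>l\<close> and \<open>m\<close> may be exchanged. Starting from the rectangles with sides between 8 and 15,
  this gives \<open>\<delta>\<^sub>k(l, m) > 0\<close> for all \<open>l, m \<ge> 8\<close> and \<open>k \<noteq> 1\<close>; it also bounds \<open>\<delta>\<^sub>k(l, m)\<close> from below by the
  central difference of an \<open>r \<times> r\<close> square, for even \<open>r\<close> slightly below \<open>sqrt s\<close>.

  The central difference is a Fourier integral of \<open>(1 - cos x) R(x)\<close>, where \<open>R(x)\<close> is the rotated
  Gaussian polynomial at \<open>exp(i x)\<close>. On \<open>[0, pi / r]\<close> it is nonnegative, being a quotient of products of
  sines, and \<open>x\<close> of order \<open>1 / r\<^sup>2\<close> alone contributes \<open>4\<^sup>r\<close> up to a power of \<open>r\<close>. On \<open>[pi / r, pi]\<close> the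
  \<open>q\<close>-binomial theorem exhibits the Gaussian coefficient as a coefficient of \<open>\<Prod>i<2r. (1 + q\<^sup>i X)\<close>, whose
  supremum over the unit circle is at most \<open>4\<^sup>r exp(- r / 6)\<close>. Hence the central difference exceeds \<open>2\<^sup>r\<close>
  for all large even \<open>r\<close>, and smaller \<open>s\<close> are absorbed into the constant.
\<close>

hide_const (open) Poly_Mapping.degree

abbreviation lookup where "lookup \<equiv> Poly_Mapping.lookup"
abbreviation keys where "keys \<equiv> Poly_Mapping.keys"

section \<open>Gaussian polynomials\<close>

text \<open>The q-Pascal rule: a partition with at most l + 1 parts, each at most m + 1, either has
  no part m + 1 or loses one such part. The coefficient ring stays generic: nat for counting, int
  for division, complex for evaluation.\<close>

fun gauss_poly :: "nat \<Rightarrow> nat \<Rightarrow> 'a::comm_semiring_1 poly" where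
  "gauss_poly 0 m = 1"
| "gauss_poly (Suc l) 0 = 1"
| "gauss_poly (Suc l) (Suc m) = gauss_poly (Suc l) m + monom 1 (Suc m) * gauss_poly l (Suc m)"

lemma gauss_poly_0_right [simp]: "gauss_poly l 0 = 1"
  by (cases l) auto

abbreviation gcoeff :: "nat \<Rightarrow> nat \<Rightarrow> nat \<Rightarrow> nat" where
  "gcoeff l m k \<equiv> coeff (gauss_poly l m) k"

lemma coeff_gauss_poly: "coeff (gauss_poly l m :: 'a::comm_semiring_1 poly) k = of_nat (gcoeff l m k)"
  by (induction l m arbitrary: k rule: gauss_poly.induct) (auto simp: coeff_monom_mult)

text \<open>After clearing denominators both summands of the recurrence share the factor
  \<open>?N l (Suc m)\<close>, and q^(m+1) - 1 + q^(m+1) (q^(l+1) - 1) = q^(l+m+2) - 1.\<close>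

lemma gauss_poly_product:
  "gauss_poly l m * (\<Prod>i=1..l. monom 1 i - 1) = (\<Prod>i=1..l. monom 1 (m + i) - 1 :: 'a::comm_ring_1 poly)"
proof (induction l m rule: gauss_poly.induct)
  case (3 l m)
  let ?D = "\<lambda>l. \<Prod>i=1..l. monom 1 i - 1 :: 'a poly"
  let ?N = "\<lambda>l m. \<Prod>i=1..l. monom 1 (m + i) - 1 :: 'a poly"
  have D: "?D (Suc l) = ?D l * (monom 1 (Suc l) - 1)"
    by simp
  have N: "?N (Suc l) m = (monom 1 (Suc m) - 1) * ?N l (Suc m)"
  proof -
    have "?N (Suc l) m = (\<Prod>i\<in>{0..l}. monom 1 (m + Suc i) - 1)"
      using prod.shift_bounds_cl_Suc_ivl[of "\<lambda>i. monom 1 (m + i) - 1 :: 'a poly" 0 l] by simp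
    then show ?thesis by (simp add: prod.atLeast_Suc_atMost)
  qed
  have "gauss_poly (Suc l) (Suc m) * ?D (Suc l)
      = gauss_poly (Suc l) m * ?D (Suc l) + monom 1 (Suc m) * (gauss_poly l (Suc m) * ?D l) * (monom 1 (Suc l) - 1)"
    unfolding D gauss_poly.simps by (simp only: algebra_simps)
  also have "\<dots> = (monom 1 (Suc m) - 1) * ?N l (Suc m) + monom 1 (Suc m) * ?N l (Suc m) * (monom 1 (Suc l) - 1)"
    using 3 N by simp
  also have "\<dots> = ?N l (Suc m) * (monom 1 (Suc m) * monom 1 (Suc l) - 1)"
    by (simp only: algebra_simps mult_1 mult_1_right)
  also have "\<dots> = ?N (Suc l) (Suc m)"
    by (simp add: mult_monom algebra_simps)
  finally show ?case .
qed auto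

lemma monom_minus_one_neq_0: "i > 0 \<Longrightarrow> monom 1 i - 1 \<noteq> (0 :: 'a::comm_ring_1 poly)"
proof
  assume "i > 0" "monom 1 i - 1 = (0 :: 'a poly)"
  then have "coeff (monom 1 i - 1 :: 'a poly) i = 0" by simp
  with \<open>i > 0\<close> show False by simp
qed

lemma q_binomial_eq_gauss_poly: "q_binomial l m = gauss_poly l m"
proof -
  have "(\<Prod>i=1..l. monom 1 i - 1 :: int poly) \<noteq> 0"
    using monom_minus_one_neq_0[where 'a = int] by (auto simp: prod_zero_iff)
  then show ?thesis
    using q_binomial_exact[of l m] gauss_poly_product[of l m, where 'a = int] by (metis mult_right_cancel)
qed

lemma qbin_coeff_eq: "qbin_coeff k l m = int (gcoeff l m k)"
  by (simp add: qbin_coeff_def q_binomial_eq_gauss_poly coeff_gauss_poly[where 'a = int])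

text \<open>The recurrence is not visibly symmetric, so the symmetric denominator
  \<open>?D 1 l * ?D 1 m\<close> is cleared and then cancelled over the integers.\<close>

lemma gcoeff_commute: "gcoeff l m k = gcoeff m l k"
proof -
  let ?D = "\<lambda>a b. \<Prod>i\<in>{a..b}. monom 1 i - 1 :: int poly"
  have "gauss_poly l m * ?D 1 l * ?D 1 m = ?D 1 (l + m)" for l m
  proof -
    have "(\<Prod>i=1..l. monom 1 (m + i) - 1 :: int poly) = ?D (m + 1) (m + l)"
      using prod.shift_bounds_cl_nat_ivl[of "\<lambda>i. monom 1 i - 1 :: int poly" 1 m l]
      by (simp add: add.commute)
    moreover have "?D 1 (l + m) = ?D 1 m * ?D (m + 1) (m + l)"
      by (subst prod.ub_add_nat[symmetric]) (auto simp: add.commute)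
    ultimately show ?thesis using gauss_poly_product[of l m, where 'a = int] by (simp add: algebra_simps)
  qed
  from this[of l m] this[of m l]
  have "gauss_poly l m * (?D 1 l * ?D 1 m) = gauss_poly m l * (?D 1 l * ?D 1 m)"
    by (simp only: mult_ac add.commute)
  moreover have "?D 1 l * ?D 1 m \<noteq> 0"
    using monom_minus_one_neq_0[where 'a = int] by (auto simp: prod_zero_iff)
  ultimately have "gauss_poly l m = (gauss_poly m l :: int poly)" by (metis mult_right_cancel)
  then have "coeff (gauss_poly l m :: int poly) k = coeff (gauss_poly m l) k" by simp
  then show ?thesis by (simp only: coeff_gauss_poly[where 'a = int] of_nat_eq_iff)
qed

text \<open>Exponent vectors of degree \<open>l\<close> in \<open>x\<^sub>0, \<dots>, x\<^sub>m\<close>; the multiplicities of the parts of a partition of \<open>k\<close>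
  in an \<open>l \<times> m\<close> rectangle, with zeros added to make exactly \<open>l\<close> parts.\<close>
definition Mon :: "nat \<Rightarrow> nat \<Rightarrow> nat \<Rightarrow> (nat \<Rightarrow>\<^sub>0 nat) set" where
  "Mon l m k = {M. keys M \<subseteq> {..m} \<and> (\<Sum>i\<le>m. lookup M i) = l \<and> (\<Sum>i\<le>m. i * lookup M i) = k}"

lemma Mon_add: "M \<in> Mon l m k \<Longrightarrow> N \<in> Mon l' m k' \<Longrightarrow> M + N \<in> Mon (l + l') m (k + k')"
  using Poly_Mapping.keys_add[of M N]
  by (auto simp: Mon_def lookup_add sum.distrib algebra_simps)

lemma single_Mon: "i \<le> m \<Longrightarrow> Poly_Mapping.single i 1 \<in> Mon 1 m i"
  by (auto simp: Mon_def lookup_single when_def if_distrib[of "\<lambda>x. _ * x"] cong: if_cong)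

lemma Mon_0: "Mon 0 m k = (if k = 0 then {0} else {})"
proof -
  have "M = 0" if "keys M \<subseteq> {..m}" "\<forall>i\<le>m. lookup M i = 0" for M :: "nat \<Rightarrow>\<^sub>0 nat"
    using that by (intro poly_mapping_eqI) (auto simp: in_keys_iff)
  then show ?thesis by (auto simp: Mon_def)
qed

lemma Mon_diff:
  assumes "M \<in> Mon l m k" "i \<in> keys M"
  shows "i \<le> m" "i \<le> k" "l > 0" "M - Poly_Mapping.single i 1 \<in> Mon (l - 1) m (k - i)"
    "M = Poly_Mapping.single i 1 + (M - Poly_Mapping.single i 1)"
proof -
  let ?N = "M - Poly_Mapping.single i 1"
  show im: "i \<le> m" using assms by (auto simp: Mon_def)
  have pos: "lookup M i > 0" using assms(2) by (simp add: in_keys_iff)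
  then show M: "M = Poly_Mapping.single i 1 + ?N"
    by (intro poly_mapping_eqI) (auto simp: lookup_add lookup_minus lookup_single when_def)
  define l' k' where "l' = (\<Sum>j\<le>m. lookup ?N j)" and "k' = (\<Sum>j\<le>m. j * lookup ?N j)"
  have "keys ?N \<subseteq> keys M" by (auto simp: in_keys_iff lookup_minus)
  then have N: "?N \<in> Mon l' m k'" using assms by (auto simp: Mon_def l'_def k'_def)
  then have "M \<in> Mon (1 + l') m (i + k')" using Mon_add[OF single_Mon[OF im] N] M by simp
  then have "l = 1 + l'" "k = i + k'" using assms(1) by (auto simp: Mon_def)
  then show "i \<le> k" "l > 0" "?N \<in> Mon (l - 1) m (k - i)" using N by auto
qed

lemma Mon_m_0: "Mon l 0 k = (if k = 0 then {Poly_Mapping.single 0 l} else {})"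
proof -
  have "M = Poly_Mapping.single 0 (lookup M 0)" if "keys M \<subseteq> {0}" for M :: "nat \<Rightarrow>\<^sub>0 nat"
    using that by (intro poly_mapping_eqI) (auto simp: in_keys_iff lookup_single when_def)
  moreover have "lookup (Poly_Mapping.single 0 l) 0 = l" "keys (Poly_Mapping.single 0 l) \<subseteq> {0::nat}" for l :: nat
    by auto
  ultimately show ?thesis unfolding Mon_def by (auto simp del: keys_single)
qed

text \<open>Splitting by whether the last variable divides the monomial reproduces the recurrence of
  \<open>gauss_poly\<close>, which makes the two counts agree.\<close>

lemma Mon_Suc_Suc:
  "Mon (Suc l) (Suc m) k = Mon (Suc l) m k \<union>
     (if Suc m \<le> k then (\<lambda>M. Poly_Mapping.single (Suc m) 1 + M) ` Mon l (Suc m) (k - Suc m) else {})"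
    (is "?L = ?A \<union> ?B")
  and Mon_Suc_Suc_disjoint:
  "Mon (Suc l) m k \<inter> (\<lambda>M. Poly_Mapping.single (Suc m) 1 + M) ` N = {}"
proof -
  have "M \<in> ?A \<union> ?B" if "M \<in> ?L" for M
  proof (cases "Suc m \<in> keys M")
    case True
    from Mon_diff[OF that this] show ?thesis by auto
  next
    case False
    then have "lookup M (Suc m) = 0" by (simp add: in_keys_iff)
    moreover have "keys M \<subseteq> {..Suc m}" using that by (simp add: Mon_def)
    then have "keys M \<subseteq> {..m}" using False by (metis atMost_Suc subset_insert)
    ultimately have "M \<in> ?A" using that by (simp add: Mon_def)
    then show ?thesis by simp
  qed
  moreover have "M \<in> ?L" if "M \<in> ?A" for M
  proof -
    have keys: "keys M \<subseteq> {..m}" using that by (simp add: Mon_def)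
    then have "Suc m \<notin> keys M" by auto
    then have "lookup M (Suc m) = 0" by (simp add: in_keys_iff)
    moreover have "keys M \<subseteq> {..Suc m}" using keys by auto
    ultimately show ?thesis using that by (simp add: Mon_def)
  qed
  moreover have "M \<in> ?L" if M: "M \<in> ?B" for M
  proof -
    obtain N where N: "Suc m \<le> k" "N \<in> Mon l (Suc m) (k - Suc m)" "M = Poly_Mapping.single (Suc m) 1 + N"
      using M by (cases "Suc m \<le> k") auto
    then show ?thesis using Mon_add[OF single_Mon[of "Suc m" "Suc m"] N(2)] by simp
  qed
  ultimately show "?L = ?A \<union> ?B" by blast
  show "Mon (Suc l) m k \<inter> (\<lambda>M. Poly_Mapping.single (Suc m) 1 + M) ` N = {}"
  proof -
    have "M \<notin> Mon (Suc l) m k" if "lookup M (Suc m) > 0" for M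
    proof -
      have "Suc m \<in> keys M" using that by (simp add: in_keys_iff)
      then have "\<not> keys M \<subseteq> {..m}" by auto
      then show ?thesis by (simp add: Mon_def)
    qed
    moreover have "lookup (Poly_Mapping.single (Suc m) 1 + M) (Suc m) > 0" for M :: "nat \<Rightarrow>\<^sub>0 nat"
      by (simp add: lookup_add)
    ultimately show ?thesis by blast
  qed
qed

lemma finite_Mon: "finite (Mon l m k)"
  and card_Mon: "card (Mon l m k) = gcoeff l m k"
proof -
  have "finite (Mon l m k) \<and> card (Mon l m k) = gcoeff l m k"
  proof (induction l m arbitrary: k rule: gauss_poly.induct)
    case (3 l m)
    have "inj (\<lambda>M. Poly_Mapping.single (Suc m) (1::nat) + M)" by (auto intro: injI)
    then have "card ((\<lambda>M. Poly_Mapping.single (Suc m) 1 + M) ` Mon l (Suc m) (k - Suc m))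
        = card (Mon l (Suc m) (k - Suc m))"
      by (intro card_image) (auto intro: inj_on_subset)
    then show ?case
      using 3 Mon_Suc_Suc_disjoint[of l m k "Mon l (Suc m) (k - Suc m)"]
      by (auto simp: Mon_Suc_Suc card_Un_disjoint coeff_monom_mult)
  qed (auto simp: Mon_0 Mon_m_0)
  then show "finite (Mon l m k)" "card (Mon l m k) = gcoeff l m k" by auto
qed

section \<open>Kernels of linear maps\<close>

text \<open>Half of rank-nullity, phrased with independent sets because the ambient polynomial ring
  is infinite dimensional. A basis \<open>I\<close> of the kernel and preimages \<open>J\<close> of
  a basis of the image together span \<open>B\<close>.\<close>

lemma (in Vector_Spaces.linear) kernel_independent_lower:
  assumes "finite B" "vs1.independent B" "finite C" "f ` vs1.span B \<subseteq> vs2.span C"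
  obtains I where "I \<subseteq> vs1.span B" "\<And>x. x \<in> I \<Longrightarrow> f x = 0" "vs1.independent I" "finite I"
    "card B \<le> card I + card C"
proof -
  obtain I where I: "I \<subseteq> {x \<in> vs1.span B. f x = 0}" "vs1.independent I"
      "{x \<in> vs1.span B. f x = 0} \<subseteq> vs1.span I"
    by (rule vs1.maximal_independent_subset)
  obtain E where E: "E \<subseteq> f ` vs1.span B" "vs2.independent E" "f ` vs1.span B \<subseteq> vs2.span E"
    by (rule vs2.maximal_independent_subset)
  from E(1) obtain J where J: "J \<subseteq> vs1.span B" "inj_on f J" "E = f ` J"
    by (meson subset_image_inj)
  have "finite E \<and> card E \<le> card C"
    using assms E by (intro vs2.independent_span_bound) auto
  then have J_card: "finite J" "card J \<le> card C"
    using J by (auto simp: card_image finite_image_iff)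
  have "finite I \<and> card I \<le> card B"
    using assms I by (intro vs1.independent_span_bound) auto
  then have "finite I" ..
  have "vs1.span B \<subseteq> vs1.span (I \<union> J)"
  proof
    fix x assume x: "x \<in> vs1.span B"
    then have "f x \<in> f ` vs1.span J" using E(3) J(3) span_image by auto
    then obtain y where y: "y \<in> vs1.span J" "f x = f y" by auto
    then have "y \<in> vs1.span B" using J(1) by (metis vs1.span_minimal vs1.subspace_span subsetD)
    then have "x - y \<in> vs1.span I" using I(3) x y by (auto simp: diff vs1.span_diff)
    then have "(x - y) + y \<in> vs1.span (I \<union> J)"
      by (intro vs1.span_add) (use y(1) vs1.span_mono in blast)+
    then show "x \<in> vs1.span (I \<union> J)" by simp
  qed
  then have "card B \<le> card (I \<union> J)"
    using vs1.independent_span_bound[of "I \<union> J" B] assms(2) \<open>finite I\<close> J_card vs1.span_superset[of B] by auto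
  also have "\<dots> \<le> card I + card C"
    using card_Un_le[of I J] J_card(2) by linarith
  finally show ?thesis using that I \<open>finite I\<close> by auto
qed

text \<open>The opposite half: extend \<open>I\<close> to a basis \<open>E\<close> of the span of
  \<open>B\<close>; the images of \<open>E - I\<close> span the image, so there are at least
  \<open>card C\<close> of them.\<close>

lemma (in Vector_Spaces.linear) kernel_independent_upper:
  assumes "finite B" "vs2.independent C" "C \<subseteq> f ` vs1.span B"
    and I: "vs1.independent I" "I \<subseteq> vs1.span B" "\<And>x. x \<in> I \<Longrightarrow> f x = 0"
  shows "card I + card C \<le> card B"
proof -
  obtain E where E: "I \<subseteq> E" "E \<subseteq> vs1.span B" "vs1.independent E" "vs1.span B \<subseteq> vs1.span E"
    using vs1.maximal_independent_subset_extend[OF I(2,1)] by blast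
  have fin: "finite E" and card: "card E \<le> card B"
    using vs1.independent_span_bound[OF assms(1) E(3,2)] by auto
  have "f ` vs1.span B \<subseteq> vs2.span (f ` (E - I))"
  proof -
    have "f ` E \<subseteq> insert 0 (f ` (E - I))" using I(3) by auto
    then have "vs2.span (f ` E) \<subseteq> vs2.span (f ` (E - I))"
      by (metis vs2.span_insert_0 vs2.span_mono)
    then show ?thesis using E(4) by (auto simp: span_image)
  qed
  then have "card C \<le> card (f ` (E - I))"
    using vs2.independent_span_bound[of "f ` (E - I)" C] assms(2,3) fin by auto
  also have "\<dots> \<le> card (E - I)" by (rule card_image_le) (use fin in simp)
  finally show ?thesis using E(1) fin card card_Diff_subset[of I E] card_mono[of E I] finite_subset[of I E] by linarith
qed

section \<open>Derivations of the polynomial ring\<close>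

type_synonym mpoly = "(nat \<Rightarrow>\<^sub>0 nat) \<Rightarrow>\<^sub>0 real"

definition scl :: "real \<Rightarrow> mpoly \<Rightarrow> mpoly" where
  "scl c f = Poly_Mapping.single 0 c * f"

lemma lookup_scl [simp]: "lookup (scl c f) M = c * lookup f M"
proof -
  have "scl c f = Poly_Mapping.map ((*) c) f" by (simp add: scl_def mult_map_scale_conv_mult)
  then show ?thesis by (simp add: Poly_Mapping.map.rep_eq when_def)
qed

lemma scl_mult_left: "scl c f * g = scl c (f * g)"
  and scl_mult_right: "f * scl c g = scl c (f * g)"
  by (simp_all add: scl_def mult_ac)

lemma scl_single: "scl c (Poly_Mapping.single M a) = Poly_Mapping.single M (c * a)"
  by (simp add: scl_def mult_single)

interpretation mp: vector_space scl
  by unfold_locales (auto simp: lookup_add algebra_simps intro!: poly_mapping_eqI)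

definition derivation :: "(mpoly \<Rightarrow> mpoly) \<Rightarrow> bool" where
  "derivation E \<longleftrightarrow> Vector_Spaces.linear scl scl E \<and> (\<forall>f g. E (f * g) = E f * g + f * E g)"

abbreviation var :: "nat \<Rightarrow> mpoly" where
  "var i \<equiv> Poly_Mapping.single (Poly_Mapping.single i 1) 1"

text \<open>The partial derivative of the monomial \<open>M\<close> times \<open>d i\<close>. The
  subtraction truncates only where the factor \<open>lookup M i\<close> is 0.\<close>

definition deriv_term :: "(nat \<Rightarrow> mpoly) \<Rightarrow> (nat \<Rightarrow>\<^sub>0 nat) \<Rightarrow> nat \<Rightarrow> mpoly" where
  "deriv_term d M i = Poly_Mapping.single (M - Poly_Mapping.single i 1) (of_nat (lookup M i)) * d i"

definition der :: "(nat \<Rightarrow> mpoly) \<Rightarrow> mpoly \<Rightarrow> mpoly" where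
  "der d f = (\<Sum>M\<in>keys f. scl (lookup f M) (\<Sum>i\<in>keys M. deriv_term d M i))"

lemma deriv_term_eq_0: "i \<notin> keys M \<Longrightarrow> deriv_term d M i = 0"
  by (simp add: deriv_term_def in_keys_iff)

lemma der_superset:
  assumes "finite S" "keys f \<subseteq> S"
  shows "der d f = (\<Sum>M\<in>S. scl (lookup f M) (\<Sum>i\<in>keys M. deriv_term d M i))"
  unfolding der_def using assms
  by (intro sum.mono_neutral_left) (auto simp: in_keys_iff)

lemma linear_der: "Vector_Spaces.linear scl scl (der d)"
proof unfold_locales
  fix f g :: mpoly and c
  let ?S = "keys f \<union> keys g"
  have "keys (f + g) \<subseteq> ?S" by (rule Poly_Mapping.keys_add)
  then show "der d (f + g) = der d f + der d g"
    by (simp add: der_superset[of ?S] lookup_add mp.scale_left_distrib sum.distrib)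
  have "keys (scl c f) \<subseteq> keys f" by (auto simp: in_keys_iff)
  then show "der d (scl c f) = scl c (der d f)"
    by (simp add: der_superset[of "keys f"] mp.scale_sum_right)
qed

lemma der_single: "der d (Poly_Mapping.single M a) = scl a (\<Sum>i\<in>keys M. deriv_term d M i)"
  by (simp add: der_superset[of "{M}"])

lemma deriv_term_add:
  "deriv_term d (M + N) i = deriv_term d M i * Poly_Mapping.single N 1 + Poly_Mapping.single M 1 * deriv_term d N i"
proof -
  have 1: "Poly_Mapping.single (M + N - Poly_Mapping.single i 1) (real (lookup M i))
      = Poly_Mapping.single (M - Poly_Mapping.single i 1) (real (lookup M i)) * Poly_Mapping.single N 1" for M N
  proof (cases "lookup M i = 0")
    case False
    then have "M + N - Poly_Mapping.single i 1 = M - Poly_Mapping.single i 1 + N"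
      by (intro poly_mapping_eqI) (auto simp: lookup_add lookup_minus lookup_single when_def)
    then show ?thesis by (simp add: mult_single)
  qed simp
  show ?thesis
    unfolding deriv_term_def lookup_add of_nat_add single_add distrib_right
    using 1[of M N] 1[of N M] by (simp add: mult_ac add.commute)
qed

lemma linear_single_induct:
  assumes "Vector_Spaces.linear scl scl E" "Vector_Spaces.linear scl scl F"
    and "\<And>M. E (Poly_Mapping.single M 1) = F (Poly_Mapping.single M 1)"
  shows "E f = F f"
proof -
  interpret E: Vector_Spaces.linear scl scl E by fact
  interpret F: Vector_Spaces.linear scl scl F by fact
  have s: "f = (\<Sum>M\<in>keys f. scl (lookup f M) (Poly_Mapping.single M 1))"
    by (intro poly_mapping_eqI)
       (auto simp: lookup_sum lookup_single when_def in_keys_iff if_distrib[of "\<lambda>x. _ * x"] cong: if_cong)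
  show ?thesis
    by (subst (1 2) s) (simp add: E.sum F.sum E.scale F.scale assms(3))
qed

text \<open>The Leibniz rule holds on monomials by \<open>deriv_term_add\<close>. Both sides are
  linear in each factor, so it extends first in one factor and then, by commutativity, in the
  other.\<close>

lemma derivation_der: "derivation (der d)"
proof -
  interpret D: Vector_Spaces.linear scl scl "der d" by (rule linear_der)
  have 1: "der d (Poly_Mapping.single M 1 * Poly_Mapping.single N 1) =
     der d (Poly_Mapping.single M 1) * Poly_Mapping.single N 1 + Poly_Mapping.single M 1 * der d (Poly_Mapping.single N 1)" for M N
  proof -
    let ?S = "keys M \<union> keys N"
    have S: "(\<Sum>i\<in>keys L. deriv_term d L i) = (\<Sum>i\<in>?S. deriv_term d L i)" if "keys L \<subseteq> ?S" for L
      using that by (intro sum.mono_neutral_left) (auto simp: deriv_term_eq_0)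
    have "der d (Poly_Mapping.single M 1 * Poly_Mapping.single N 1) = (\<Sum>i\<in>?S. deriv_term d (M + N) i)"
      using S[of "M + N"] Poly_Mapping.keys_add[of M N] by (simp add: mult_single der_single)
    then show ?thesis
      by (simp add: der_single S deriv_term_add sum.distrib sum_distrib_left sum_distrib_right)
  qed
  have lin: "Vector_Spaces.linear scl scl (\<lambda>f. der d (f * g))"
    "Vector_Spaces.linear scl scl (\<lambda>f. der d f * g + f * der d g)" for g
    by unfold_locales (auto simp: D.add D.scale algebra_simps mp.scale_right_distrib scl_mult_left scl_mult_right)
  have 2: "der d (f * Poly_Mapping.single N 1) = der d f * Poly_Mapping.single N 1 + f * der d (Poly_Mapping.single N 1)" for f N
    by (rule linear_single_induct[OF lin]) (rule 1)
  have 3: "der d (g * f) = der d g * f + g * der d f" for f g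
    using linear_single_induct[OF lin[of f], of g] 2[of f] by (simp add: mult.commute add.commute)
  show ?thesis
    unfolding derivation_def using linear_der 3 by blast
qed

lemma der_var: "der d (var i) = d i"
  by (simp add: der_single deriv_term_def)

text \<open>Reduces the sl(2) relation to a check on the variables.\<close>

lemma derivation_commutator:
  assumes "derivation D" "derivation U"
  shows "derivation (\<lambda>f. D (U f) - U (D f))"
proof -
  interpret D: Vector_Spaces.linear scl scl D using assms by (simp add: derivation_def)
  interpret U: Vector_Spaces.linear scl scl U using assms by (simp add: derivation_def)
  have "Vector_Spaces.linear scl scl (\<lambda>f. D (U f) - U (D f))"
    by unfold_locales (auto simp: D.add U.add D.scale U.scale mp.scale_right_diff_distrib)
  moreover have "D (f * g) = D f * g + f * D g" "U (f * g) = U f * g + f * U g" for f g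
    using assms by (auto simp: derivation_def)
  ultimately show ?thesis by (simp add: derivation_def D.add U.add algebra_simps)
qed

section \<open>Highest weight vectors\<close>

text \<open>\<open>lower\<close> and \<open>raise m\<close> are the ladder operators of sl(2). Their
  coefficients vanish at i = 0 and i = m respectively, so neither the truncated \<open>i - 1\<close>
  nor a variable beyond x_m ever enters.\<close>

definition lower :: "mpoly \<Rightarrow> mpoly" where
  "lower = der (\<lambda>i. scl (real i) (var (i - 1)))"

definition raise :: "nat \<Rightarrow> mpoly \<Rightarrow> mpoly" where
  "raise m = der (\<lambda>i. scl (real m - real i) (var (Suc i)))"

abbreviation xmon :: "(nat \<Rightarrow>\<^sub>0 nat) \<Rightarrow> mpoly" where
  "xmon M \<equiv> Poly_Mapping.single M 1"

definition Hom :: "nat \<Rightarrow> nat \<Rightarrow> nat \<Rightarrow> mpoly set" where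
  "Hom l m k = mp.span (xmon ` Mon l m k)"

lemma subspace_Hom: "mp.subspace (Hom l m k)"
  by (simp add: Hom_def)

lemma xmon_Hom: "M \<in> Mon l m k \<Longrightarrow> xmon M \<in> Hom l m k"
  unfolding Hom_def by (intro mp.span_base) auto

lemma inj_xmon: "inj_on xmon S"
  by (rule inj_onI) (metis keys_single singleton_inject zero_neq_one)

lemma independent_xmon: "mp.independent (xmon ` S)"
proof -
  have "mp.independent (xmon ` T)" if "finite T" for T
  proof (rule mp.independent_if_scalars_zero)
    fix u x assume "(\<Sum>y\<in>xmon ` T. scl (u y) y) = 0" "x \<in> xmon ` T"
    then obtain M where M: "M \<in> T" "x = xmon M" and 0: "(\<Sum>N\<in>T. scl (u (xmon N)) (xmon N)) = 0"
      by (auto simp: sum.reindex[OF inj_xmon])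
    have "lookup (\<Sum>N\<in>T. scl (u (xmon N)) (xmon N)) M = u (xmon M)"
      using \<open>finite T\<close> M(1)
      by (simp add: lookup_sum lookup_single when_def if_distrib[of "\<lambda>x. _ * x"] cong: if_cong)
    then show "u x = 0" using 0 M(2) by simp
  qed (use that in auto)
  then show ?thesis
    unfolding mp.independent_explicit_finite_subsets[of "xmon ` S"]
    by (metis (no_types, lifting) finite_subset_image mp.independent_explicit_finite_subsets subset_refl)
qed

lemma card_xmon_image: "card (xmon ` Mon l m k) = gcoeff l m k"
  by (simp add: card_image inj_xmon card_Mon)

lemma deriv_term_scl_var:
  "deriv_term (\<lambda>i. scl (c i) (var (s i))) M i =
     scl (of_nat (lookup M i) * c i) (xmon (M - Poly_Mapping.single i 1 + Poly_Mapping.single (s i) 1))"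
  by (simp add: deriv_term_def scl_mult_right mult_single scl_single mult.commute add.commute)

lemma Mon_exchange:
  assumes "M \<in> Mon l m k" "i \<in> keys M" "j \<le> m"
  shows "M - Poly_Mapping.single i 1 + Poly_Mapping.single j 1 \<in> Mon l m (k - i + j)"
proof -
  have "l - 1 + 1 = l" using Mon_diff(3)[OF assms(1,2)] by simp
  then show ?thesis using Mon_add[OF Mon_diff(4)[OF assms(1,2)] single_Mon[OF assms(3)]] by metis
qed

lemma linear_lower: "Vector_Spaces.linear scl scl lower"
  by (simp add: lower_def linear_der)

lemma linear_raise: "Vector_Spaces.linear scl scl (raise m)"
  by (simp add: raise_def linear_der)

lemma linear_image_Hom:
  assumes "Vector_Spaces.linear scl scl E" "mp.subspace V" "\<And>M. M \<in> Mon l m k \<Longrightarrow> E (xmon M) \<in> V"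
    and f: "f \<in> Hom l m k"
  shows "E f \<in> V"
proof -
  interpret E: Vector_Spaces.linear scl scl E by fact
  have "mp.subspace {x. E x \<in> V}" using assms(2) by (rule E.subspace_linear_preimage)
  then have "Hom l m k \<subseteq> {x. E x \<in> V}"
    unfolding Hom_def by (intro mp.span_minimal) (use assms(3) in auto)
  then show ?thesis using f by auto
qed

lemma lower_Hom_0:
  assumes "f \<in> Hom l m 0"
  shows "lower f = 0"
proof -
  have "lower (xmon M) \<in> {0}" if M: "M \<in> Mon l m 0" for M
  proof -
    have "i = 0" if "i \<in> keys M" for i using Mon_diff(2)[OF M that] by simp
    then show ?thesis
      unfolding lower_def der_single deriv_term_scl_var by (auto intro!: sum.neutral)
  qed
  then show ?thesis using linear_image_Hom[OF linear_lower mp.subspace_single_0 _ assms] by blast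
qed

lemma lower_Hom:
  assumes "f \<in> Hom l m (Suc k)"
  shows "lower f \<in> Hom l m k"
proof (rule linear_image_Hom[OF linear_lower subspace_Hom _ assms])
  fix M assume M: "M \<in> Mon l m (Suc k)"
  have "deriv_term (\<lambda>i. scl (real i) (var (i - 1))) M i \<in> Hom l m k" if i: "i \<in> keys M" for i
  proof (cases "i = 0")
    case True
    then show ?thesis unfolding deriv_term_scl_var by (simp add: Hom_def mp.span_zero)
  next
    case False
    have "i \<le> m" "i \<le> Suc k" using Mon_diff[OF M i] by auto
    then have "M - Poly_Mapping.single i 1 + Poly_Mapping.single (i - 1) 1 \<in> Mon l m k"
      using Mon_exchange[OF M i, of "i - 1"] False by (simp add: Suc_diff_le)
    then show ?thesis
      unfolding deriv_term_scl_var by (intro mp.subspace_scale[OF subspace_Hom] xmon_Hom)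
  qed
  then show "lower (xmon M) \<in> Hom l m k"
    unfolding lower_def der_single
    by (intro mp.subspace_scale[OF subspace_Hom] mp.subspace_sum[OF subspace_Hom]) auto
qed

lemma raise_Hom:
  assumes "f \<in> Hom l m k"
  shows "raise m f \<in> Hom l m (Suc k)"
proof (rule linear_image_Hom[OF linear_raise subspace_Hom _ assms])
  fix M assume M: "M \<in> Mon l m k"
  have "deriv_term (\<lambda>i. scl (real m - real i) (var (Suc i))) M i \<in> Hom l m (Suc k)" if i: "i \<in> keys M" for i
  proof (cases "i = m")
    case True
    then show ?thesis unfolding deriv_term_scl_var by (simp add: Hom_def mp.span_zero)
  next
    case False
    have "i \<le> m" "i \<le> k" using Mon_diff[OF M i] by auto
    then have "M - Poly_Mapping.single i 1 + Poly_Mapping.single (Suc i) 1 \<in> Mon l m (Suc k)"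
      using Mon_exchange[OF M i, of "Suc i"] False by simp
    then show ?thesis
      unfolding deriv_term_scl_var by (intro mp.subspace_scale[OF subspace_Hom] xmon_Hom)
  qed
  then show "raise m (xmon M) \<in> Hom l m (Suc k)"
    unfolding raise_def der_single
    by (intro mp.subspace_scale[OF subspace_Hom] mp.subspace_sum[OF subspace_Hom]) auto
qed

section \<open>Weights and the commutation relation of sl(2)\<close>

lemma derivation_one:
  assumes "derivation E" shows "E 1 = 0"
proof -
  have "E (1 * 1) = E 1 * 1 + 1 * E 1" using assms unfolding derivation_def by blast
  then show ?thesis by simp
qed

text \<open>Under a derivation the eigenvalue of a product is the sum of the eigenvalues of the
  factors; one variable is split off at a time.\<close>

lemma derivation_eigenvalue:
  assumes "derivation E" and var: "\<And>i. i \<le> m \<Longrightarrow> E (var i) = scl (a + b * real i) (var i)"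
    and "M \<in> Mon l m k"
  shows "E (xmon M) = scl (a * real l + b * real k) (xmon M)"
  using assms(3)
proof (induction l arbitrary: M k)
  case 0
  then show ?case
    using derivation_one[OF assms(1)] by (auto simp: Mon_0 split: if_splits)
next
  case (Suc l)
  have "M \<noteq> 0" using Suc.prems by (auto simp: Mon_def)
  then obtain i where i: "i \<in> keys M" by (metis Poly_Mapping.keys_eq_empty ex_in_conv)
  let ?N = "M - Poly_Mapping.single i 1"
  note d = Mon_diff[OF Suc.prems i]
  have M: "xmon M = var i * xmon ?N" by (subst d(5)) (simp add: mult_single)
  have N: "E (xmon ?N) = scl (a * real l + b * real (k - i)) (xmon ?N)" using d(4) Suc.IH by simp
  have "E (xmon M) = E (var i) * xmon ?N + var i * E (xmon ?N)"
    using assms(1) unfolding M derivation_def by blast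
  also have "\<dots> = scl ((a + b * real i) + (a * real l + b * real (k - i))) (xmon M)"
    unfolding M N var[OF d(1)] scl_mult_left scl_mult_right by (rule mp.scale_left_distrib[symmetric])
  also have "(a + b * real i) + (a * real l + b * real (k - i)) = a * real (Suc l) + b * real k"
    using d(2) by (simp add: of_nat_diff algebra_simps)
  finally show ?case .
qed

text \<open>The commutator is a derivation scaling x_i by m - 2i, so
  \<open>derivation_eigenvalue\<close> with a = m and b = -2 gives its value on every
  monomial.\<close>

lemma lower_raise_commutator:
  assumes "f \<in> Hom l m k"
  shows "lower (raise m f) = raise m (lower f) + scl (real (l * m) - 2 * real k) f"
proof -
  let ?E = "\<lambda>f. lower (raise m f) - raise m (lower f)"
  have der: "derivation ?E"
    by (intro derivation_commutator) (simp_all add: lower_def raise_def derivation_der)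
  interpret E: Vector_Spaces.linear scl scl ?E using der by (simp add: derivation_def)
  interpret L: Vector_Spaces.linear scl scl lower by (rule linear_lower)
  interpret R: Vector_Spaces.linear scl scl "raise m" by (rule linear_raise)
  have "?E (var i) = scl (real m + (- 2) * real i) (var i)" for i
  proof -
    have L: "lower (var i) = scl (real i) (var (i - 1))" for i unfolding lower_def der_var ..
    have R: "raise m (var i) = scl (real m - real i) (var (Suc i))" for i unfolding raise_def der_var ..
    have 1: "lower (raise m (var i)) = scl ((real m - real i) * (real i + 1)) (var i)"
      unfolding R L.scale L mp.scale_scale by (simp add: add.commute)
    have 2: "raise m (lower (var i)) = scl (real i * (real m - real i + 1)) (var i)"
      unfolding L R.scale R mp.scale_scale by (cases i) simp_all
    have "?E (var i) = scl ((real m - real i) * (real i + 1) - real i * (real m - real i + 1)) (var i)"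
      unfolding 1 2 by (rule mp.scale_left_diff_distrib[symmetric])
    then show ?thesis by (simp add: algebra_simps)
  qed
  from derivation_eigenvalue[OF der this]
  have *: "?E (xmon M) = scl (real (l * m) - 2 * real k) (xmon M)" if "M \<in> Mon l m k" for M
    using that by (simp add: mult.commute)
  have "Vector_Spaces.linear scl scl (\<lambda>f. ?E f - scl (real (l * m) - 2 * real k) f)"
    by unfold_locales (simp_all add: E.add E.scale mp.scale_right_distrib mp.scale_right_diff_distrib mult.commute)
  from linear_image_Hom[OF this mp.subspace_single_0 _ assms] *
  have "?E f - scl (real (l * m) - 2 * real k) f = 0" by auto
  then show ?thesis by (simp add: algebra_simps)
qed

text \<open>If \<open>f\<close> is an eigenvector for \<open>- c\<close>, then \<open>lower f\<close> is one for a still smaller eigenvalue, in weight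
  \<open>k - 1\<close>; at weight \<open>0\<close> only the zero vector is left.\<close>
lemma raise_lower_no_neg_eigenvalue:
  assumes "f \<in> Hom l m k" "2 * k \<le> l * m + 2" "c > 0" "raise m (lower f) = scl (- c) f"
  shows "f = 0"
  using assms
proof (induction k arbitrary: f c)
  case 0
  interpret R: Vector_Spaces.linear scl scl "raise m" by (rule linear_raise)
  have "scl (- c) f = 0" using 0 lower_Hom_0 R.zero by metis
  then show ?case using \<open>c > 0\<close> by (simp add: mp.scale_eq_0_iff)
next
  case (Suc k)
  interpret L: Vector_Spaces.linear scl scl lower by (rule linear_lower)
  let ?h = "real (l * m) - 2 * real k" and ?g = "lower f"
  have g: "?g \<in> Hom l m k" using Suc.prems(1) by (rule lower_Hom)
  have "2 * k \<le> l * m" using Suc.prems(2) by simp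
  then have h: "?h \<ge> 0" by (metis diff_ge_0_iff_ge of_nat_le_iff of_nat_mult of_nat_numeral)
  have "scl (- c) ?g = raise m (lower ?g) + scl ?h ?g"
    using lower_raise_commutator[OF g] unfolding Suc.prems(4) L.scale by simp
  then have "raise m (lower ?g) = scl (- (c + ?h)) ?g"
    by (simp add: mp.scale_left_diff_distrib algebra_simps)
  then have "?g = 0"
    using Suc.IH[OF g, of "c + ?h"] \<open>2 * k \<le> l * m\<close> h Suc.prems(3) by simp
  interpret R: Vector_Spaces.linear scl scl "raise m" by (rule linear_raise)
  have "scl (- c) f = 0" using Suc.prems(4) \<open>?g = 0\<close> R.zero by metis
  then show ?case using \<open>c > 0\<close> by (simp add: mp.scale_eq_0_iff)
qed

text \<open>By the commutator, \<open>raise m (lower f)\<close> would be a negative multiple of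
  \<open>f\<close>, which \<open>raise_lower_no_neg_eigenvalue\<close> excludes.\<close>

lemma lower_raise_inj:
  assumes "f \<in> Hom l m k" "2 * k < l * m" "lower (raise m f) = 0"
  shows "f = 0"
proof (rule raise_lower_no_neg_eigenvalue[OF assms(1)])
  show "2 * k \<le> l * m + 2" using assms by simp
  show "real (l * m) - 2 * real k > 0"
    using assms(2) by (metis diff_gt_0_iff_gt of_nat_less_iff of_nat_mult of_nat_numeral)
  show "raise m (lower f) = scl (- (real (l * m) - 2 * real k)) f"
    using lower_raise_commutator[OF assms(1)] assms(3)
    by (metis add_eq_0_iff2 mp.scale_minus_left)
qed

text \<open>At \<open>k = 0\<close> the missing predecessor counts as 0, so that the highest weight
  vector x_0^l of weight 0 is included.\<close>

definition gdiff :: "nat \<Rightarrow> nat \<Rightarrow> nat \<Rightarrow> int" where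
  "gdiff l m k = int (gcoeff l m k) - (if k = 0 then 0 else int (gcoeff l m (k - 1)))"

definition hwv :: "nat \<Rightarrow> nat \<Rightarrow> nat \<Rightarrow> mpoly set" where
  "hwv l m k = {f \<in> Hom l m k. lower f = 0}"

text \<open>The kernel of \<open>lower\<close> from weight k to weight k - 1 is at least as large as
  the difference of the two dimensions.\<close>

lemma hwv_independent:
  obtains I where "I \<subseteq> hwv l m k" "mp.independent I" "finite I" "gdiff l m k \<le> int (card I)"
proof -
  interpret L: Vector_Spaces.linear scl scl lower by (rule linear_lower)
  let ?C = "if k = 0 then {} else xmon ` Mon l m (k - 1)"
  have "lower ` mp.span (xmon ` Mon l m k) \<subseteq> mp.span ?C"
    using lower_Hom[of _ l m "k - 1"] lower_Hom_0[of _ l m] by (auto simp: Hom_def)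
  moreover have "finite (xmon ` Mon l m k)" "finite ?C" by (simp_all add: finite_Mon)
  ultimately obtain I where "I \<subseteq> mp.span (xmon ` Mon l m k)" "\<And>x. x \<in> I \<Longrightarrow> lower x = 0" "mp.independent I" "finite I"
     "card (xmon ` Mon l m k) \<le> card I + card ?C"
    using L.kernel_independent_lower[OF _ independent_xmon] by metis
  then show thesis
    by (intro that[of I]) (auto simp: hwv_def Hom_def gdiff_def card_xmon_image split: if_splits)
qed

text \<open>Up to the middle weight \<open>lower\<close> has full rank: \<open>lower\<close> after
  \<open>raise m\<close> is already injective on weight k - 1. Hence the kernel is no larger than
  the difference of dimensions.\<close>

lemma hwv_independent_bound:
  assumes "2 * k \<le> l * m" "mp.independent I" "I \<subseteq> hwv l m k"
  shows "int (card I) \<le> gdiff l m k"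
proof (cases k)
  case 0
  have "finite I \<and> card I \<le> card (xmon ` Mon l m k)"
    using assms by (intro mp.independent_span_bound) (auto simp: finite_Mon hwv_def Hom_def)
  then show ?thesis using 0 by (simp add: gdiff_def card_xmon_image)
next
  case (Suc j)
  interpret L: Vector_Spaces.linear scl scl lower by (rule linear_lower)
  interpret R: Vector_Spaces.linear scl scl "raise m" by (rule linear_raise)
  let ?LR = "\<lambda>f. lower (raise m f)"
  interpret LR: Vector_Spaces.linear scl scl ?LR
    by unfold_locales (simp_all add: L.add L.scale R.add R.scale)
  have j: "2 * j < l * m" using assms(1) Suc by simp
  have inj: "inj_on ?LR (mp.span (xmon ` Mon l m j))"
    unfolding LR.inj_on_iff_eq_0[OF mp.subspace_span] using lower_raise_inj[OF _ j] by (auto simp: Hom_def)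
  let ?C = "?LR ` xmon ` Mon l m j"
  have "mp.independent ?C"
    by (rule LR.independent_injective_image[OF independent_xmon inj])
  moreover have "?C \<subseteq> lower ` mp.span (xmon ` Mon l m k)"
    using raise_Hom[OF xmon_Hom] Suc by (auto simp: Hom_def)
  ultimately have "card I + card ?C \<le> card (xmon ` Mon l m k)"
    using assms(2,3) by (intro L.kernel_independent_upper) (auto simp: finite_Mon hwv_def Hom_def)
  moreover have "card ?C = gcoeff l m j"
    using inj_on_subset[OF inj mp.span_superset] by (subst card_image) (simp_all add: card_xmon_image)
  ultimately show ?thesis using Suc by (simp add: gdiff_def card_xmon_image)
qed

lemma Hom_mult:
  assumes "f \<in> Hom l m k" "g \<in> Hom l' m k'"
  shows "f * g \<in> Hom (l + l') m (k + k')"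
proof -
  have lin: "Vector_Spaces.linear scl scl (\<lambda>f. f * g)" for g
    by unfold_locales (simp_all add: algebra_simps scl_mult_left scl_mult_right)
  have 1: "xmon M * g \<in> Hom (l + l') m (k + k')" if "M \<in> Mon l m k" for M
  proof -
    have "xmon N * xmon M \<in> Hom (l + l') m (k + k')" if "N \<in> Mon l' m k'" for N
      using xmon_Hom[OF Mon_add[OF \<open>M \<in> Mon l m k\<close> that]] by (simp add: mult_single add.commute)
    then have "g * xmon M \<in> Hom (l + l') m (k + k')"
      by (rule linear_image_Hom[OF lin subspace_Hom _ assms(2)])
    then show ?thesis by (simp add: mult.commute)
  qed
  show ?thesis by (rule linear_image_Hom[OF lin subspace_Hom 1 assms(1)])
qed

lemma hwv_mult:
  assumes "f \<in> hwv l m k" "g \<in> hwv l' m k'"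
  shows "f * g \<in> hwv (l + l') m (k + k')"
proof -
  have "derivation lower" by (simp add: lower_def derivation_der)
  then have "lower (f * g) = lower f * g + f * lower g" unfolding derivation_def by blast
  then show ?thesis using assms Hom_mult by (auto simp: hwv_def)
qed

lemma gdiff_superadditive:
  assumes "2 * k \<le> l * m" "2 * k' \<le> l' * m" "gdiff l' m k' > 0"
  shows "gdiff l m k \<le> gdiff (l + l') m (k + k')"
proof -
  obtain I where I: "I \<subseteq> hwv l m k" "mp.independent I" "finite I" "gdiff l m k \<le> int (card I)"
    by (rule hwv_independent)
  obtain J where J: "J \<subseteq> hwv l' m k'" "mp.independent J" "gdiff l' m k' \<le> int (card J)"
    by (rule hwv_independent)
  with assms(3) have "J \<noteq> {}" by auto
  then obtain g where "g \<in> J" by auto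
  then have g: "g \<in> hwv l' m k'" "g \<noteq> 0" using J mp.dependent_zero by auto
  interpret G: Vector_Spaces.linear scl scl "\<lambda>f. f * g"
    by unfold_locales (simp_all add: algebra_simps scl_mult_left scl_mult_right)
  \<comment> \<open>The polynomial ring has no zero divisors, so multiplication by the nonzero
    \<open>g\<close> can be cancelled.\<close>
  have inj: "inj_on (\<lambda>f. f * g) S" for S using g(2) by (auto intro: inj_onI)
  have "int (card ((\<lambda>f. f * g) ` I)) \<le> gdiff (l + l') m (k + k')"
  proof (rule hwv_independent_bound)
    show "2 * (k + k') \<le> (l + l') * m" using assms(1,2) by (simp add: algebra_simps)
    show "mp.independent ((\<lambda>f. f * g) ` I)" by (rule G.independent_injective_image[OF I(2) inj])
    show "(\<lambda>f. f * g) ` I \<subseteq> hwv (l + l') m (k + k')" using I(1) g(1) hwv_mult by auto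
  qed
  then show ?thesis using I(4) by (simp add: card_image inj)
qed

lemma gdiff_commute: "gdiff l m k = gdiff m l k"
  by (simp add: gdiff_def gcoeff_commute[of l m])

section \<open>Strict unimodality\<close>

fun add_coeffs :: "int list \<Rightarrow> int list \<Rightarrow> int list" where
  "add_coeffs [] ys = ys"
| "add_coeffs xs [] = xs"
| "add_coeffs (x # xs) (y # ys) = (x + y) # add_coeffs xs ys"

lemma Poly_add_coeffs: "Poly (add_coeffs xs ys) = Poly xs + Poly ys"
  by (induction xs ys rule: add_coeffs.induct) auto

text \<open>The q-Pascal rule on coefficient lists: \<open>p\<close> is the previous entry of the
  new row, \<open>r\<close> the entry of the old row in column \<open>n\<close>, shifted by
  \<open>n\<close> places.\<close>

fun next_row :: "nat \<Rightarrow> int list \<Rightarrow> int list list \<Rightarrow> int list list" where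
  "next_row n p [] = []"
| "next_row n p (r # rs) =
     (let q = add_coeffs p (replicate n 0 @ r) in q # next_row (Suc n) q rs)"

lemma next_row_gauss_poly:
  "map Poly rs = map (gauss_poly l) [Suc n..<N] \<Longrightarrow> Poly p = gauss_poly (Suc l) n \<Longrightarrow>
    map Poly (next_row (Suc n) p rs) = map (gauss_poly (Suc l)) [Suc n..<N]"
proof (induction rs arbitrary: n p)
  case (Cons r rs)
  then have n: "Suc n < N" by (metis list.simps(3) map_is_Nil_conv upt_conv_Nil not_le_imp_less)
  with Cons.prems(1) have "Poly r = gauss_poly l (Suc n)" "map Poly rs = map (gauss_poly l) [Suc (Suc n)..<N]"
    by (simp_all add: upt_conv_Cons)
  moreover have "Poly (add_coeffs p (replicate (Suc n) 0 @ r)) = gauss_poly (Suc l) (Suc n)"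
    using Cons.prems(2) calculation(1)
    by (simp add: Poly_add_coeffs Poly_append Poly_replicate_0 del: replicate_Suc)
  ultimately show ?case
    using Cons.IH[of "Suc n"] n by (simp add: upt_conv_Cons Let_def del: replicate_Suc)
qed auto

fun increasing_upto :: "nat \<Rightarrow> int list \<Rightarrow> bool" where
  "increasing_upto 0 xs = True"
| "increasing_upto (Suc n) (x # y # zs) = (x < y \<and> increasing_upto n (y # zs))"
| "increasing_upto (Suc n) _ = False"

lemma increasing_upto_nth: "increasing_upto n xs \<Longrightarrow> j < n \<Longrightarrow> nth_default 0 xs j < nth_default 0 xs (Suc j)"
  by (induction n xs arbitrary: j rule: increasing_upto.induct) (auto simp: less_Suc_eq_0_disj)

text \<open>The lists stand for columns 1 to 15, and \<open>drop 7\<close> leaves columns 8 to 15.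
  \<open>tl\<close> removes the constant coefficient, because the coefficients 0 and 1 are equal;
  the remaining \<open>Suc l * m div 2 - 1\<close> steps run from coefficient 1 to the
  middle.\<close>

fun rows_increasing :: "nat \<Rightarrow> nat \<Rightarrow> int list list \<Rightarrow> bool" where
  "rows_increasing 0 l rs = True"
| "rows_increasing (Suc n) l rs =
    (let rs' = next_row 1 [1] rs in
      (8 \<le> Suc l \<longrightarrow> list_all (\<lambda>(m, xs). increasing_upto (Suc l * m div 2 - 1) (tl xs)) (zip [8..<16] (drop 7 rs')))
      \<and> rows_increasing n (Suc l) rs')"

lemma rows_increasingD:
  assumes "rows_increasing n l rs" "map Poly rs = map (gauss_poly l) [1..<16]" "l < l'" "l' \<le> l + n"
    and "8 \<le> l'" "8 \<le> m" "m < 16"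
  shows "\<exists>xs. Poly xs = gauss_poly l' m \<and> increasing_upto (l' * m div 2 - 1) (tl xs)"
  using assms(1-4)
proof (induction n arbitrary: l rs)
  case (Suc n)
  let ?rs = "next_row 1 [1] rs"
  have rs: "map Poly ?rs = map (gauss_poly (Suc l)) [1..<16]"
    using next_row_gauss_poly[of rs l 0 16 "[1]"] Suc.prems(2) by (simp add: one_pCons)
  show ?case
  proof (cases "l' = Suc l")
    case True
    have len: "length ?rs = 15" using arg_cong[OF rs, of length] by simp
    define i where "i = m - 8"
    have i: "i < 8" "m = i + 8" using assms(6,7) by (auto simp: i_def)
    let ?xs = "?rs ! (i + 7)"
    have "zip [8..<16] (drop 7 ?rs) ! i \<in> set (zip [8..<16] (drop 7 ?rs))"
      using i len by (intro nth_mem) simp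
    moreover have "zip [8..<16] (drop 7 ?rs) ! i = (m, ?xs)"
      using i len by (simp add: add.commute del: upt_rec_numeral)
    ultimately have "(m, ?xs) \<in> set (zip [8..<16] (drop 7 ?rs))" by simp
    then have "increasing_upto (l' * m div 2 - 1) (tl ?xs)"
      using Suc.prems(1) True assms(5) by (auto simp: Let_def list_all_iff)
    moreover have "Poly ?xs = gauss_poly l' m"
      using arg_cong[OF rs, of "\<lambda>rs. rs ! (i + 7)"] len i True by (simp add: add.commute)
    ultimately show ?thesis by blast
  next
    case False
    then show ?thesis using Suc.IH[OF _ rs] Suc.prems by (simp add: Let_def)
  qed
qed simp

lemma gdiff_pos_base:
  assumes "8 \<le> l" "l < 16" "8 \<le> m" "m < 16" "2 \<le> k" "2 * k \<le> l * m"
  shows "gdiff l m k > 0"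
proof -
  \<comment> \<open>Row 0 has the constant 1 in every column; fifteen further rows are computed from
    it.\<close>
  have "rows_increasing 15 0 (replicate 15 [1])" by code_simp
  moreover have "map Poly (replicate 15 [1]) = map (gauss_poly 0) [1..<16]"
    by (simp add: numeral_eq_Suc one_pCons)
  ultimately obtain xs where xs: "Poly xs = (gauss_poly l m :: int poly)" "increasing_upto (l * m div 2 - 1) (tl xs)"
    using rows_increasingD[of 15 0 "replicate 15 [1]" l m] assms by auto
  \<comment> \<open>Position j of \<open>tl xs\<close> holds coefficient j + 1, so this compares the
    coefficients k - 1 and k.\<close>
  have "nth_default 0 (tl xs) (k - 2) < nth_default 0 (tl xs) (Suc (k - 2))"
    using xs(2) assms(5,6) by (intro increasing_upto_nth) auto
  moreover have "nth_default 0 (tl xs) j = int (gcoeff l m (Suc j))" for j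
  proof -
    have "nth_default 0 (tl xs) j = coeff (Poly xs) (Suc j)" by (cases xs) auto
    then show ?thesis by (simp add: xs(1) coeff_gauss_poly[where 'a = int])
  qed
  moreover have "Suc (Suc (k - 2)) = k" "Suc (k - 2) = k - 1" using assms(5) by auto
  ultimately show ?thesis using assms(5) by (simp add: gdiff_def)
qed

section \<open>Positivity for all sides at least 8, and growth from a square\<close>

lemma gcoeff_0: "gcoeff l m 0 = 1"
  by (induction l m rule: gauss_poly.induct) (auto simp: coeff_monom_mult)

text \<open>Weight 1 must be avoided in both summands, since the difference vanishes there. Filling
  \<open>a\<close> up to \<open>M\<close> leaves the remainder 1 only for \<open>d = Suc M\<close>,
  where \<open>M - 1\<close> and 2 serve instead; \<open>3 \<le> M\<close> keeps
  \<open>M - 1\<close> away from 1.\<close>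

lemma split_weight:
  fixes d M :: nat
  assumes "d \<noteq> 1" "3 \<le> M"
  obtains a b where "d = a + b" "a \<le> M" "a \<noteq> 1" "b \<noteq> 1" "b \<le> max 2 (d - M)"
proof (cases "d = Suc M")
  case True
  then show ?thesis using assms by (intro that[of "M - 1" 2]) auto
next
  case False
  then show ?thesis using assms by (intro that[of "min d M" "d - M"]) auto
qed

lemma gdiff_pos:
  assumes "8 \<le> l" "8 \<le> m" "k \<noteq> 1" "2 * k \<le> l * m"
  shows "gdiff l m k > 0"
  using assms
proof (induction "l + m" arbitrary: l m k rule: less_induct)
  case less
  \<comment> \<open>The induction hypothesis is a premise here, so that the step applies to either
    side of the rectangle. A side of length at least 16 is cut into 8 and a rest of at least
    8.\<close>
  have step: "gdiff l m k > 0"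
    if "16 \<le> l" "8 \<le> m" "2 * k \<le> l * m"
      and IH: "\<And>l' k. 8 \<le> l' \<Longrightarrow> l' < l \<Longrightarrow> k \<noteq> 1 \<Longrightarrow> 2 * k \<le> l' * m \<Longrightarrow> gdiff l' m k > 0" for l m
  proof -
    \<comment> \<open>\<open>4 * m\<close> is the middle weight of the \<open>8 \<times> m\<close>
      rectangle.\<close>
    obtain a b where ab: "k = a + b" "a \<le> 4 * m" "a \<noteq> 1" "b \<noteq> 1" "b \<le> max 2 (k - 4 * m)"
      using split_weight[of k "4 * m"] less.prems(3) \<open>8 \<le> m\<close> by auto
    obtain j where j: "l = 8 + j" "8 \<le> j" using \<open>16 \<le> l\<close> by (intro that[of "l - 8"]) auto
    have "2 * 2 \<le> j * m" using j(2) \<open>8 \<le> m\<close> by (intro mult_le_mono) auto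
    then have b: "2 * b \<le> j * m" using ab(5) that(3) j(1) by (auto simp: max_def algebra_simps split: if_splits)
    have "gdiff 8 m a > 0" "gdiff j m b > 0"
      using IH[of 8 a] IH[of j b] ab j b \<open>16 \<le> l\<close> by auto
    with gdiff_superadditive[of a 8 m b j] ab(1,2) j(1) b show ?thesis by simp
  qed
  consider "k = 0" | "2 \<le> k" "l < 16" "m < 16" | "16 \<le> l" | "16 \<le> m"
    using less.prems(3) by linarith
  then show ?case
  proof cases
    case 1
    then show ?thesis by (simp add: gdiff_def gcoeff_0)
  next
    case 2
    then show ?thesis using gdiff_pos_base less.prems by simp
  next
    case 3
    show ?thesis using less.prems by (intro step 3 less.hyps) auto
  next
    case 4
    have "gdiff m l k > 0"
    proof (rule step[OF 4])
      fix l' k assume "8 \<le> l'" "l' < m" "k \<noteq> 1" "2 * k \<le> l' * l"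
      then have "gdiff l l' k > 0" using less.prems by (intro less.hyps) (auto simp: mult.commute)
      then show "gdiff l' l k > 0" by (simp add: gdiff_commute[of l'])
    qed (use less.prems in \<open>auto simp: mult.commute\<close>)
    then show ?thesis by (simp add: gdiff_commute[of l])
  qed
qed

lemma gdiff_mono_rectangle:
  assumes "8 \<le> l'" "8 \<le> m" "2 * k \<le> l * m" "d \<noteq> 1" "2 * d \<le> l' * m"
  shows "gdiff l m k \<le> gdiff (l + l') m (k + d)"
  using assms gdiff_pos by (intro gdiff_superadditive) auto

text \<open>The square grows first to \<open>l \<times> r\<close> and then to
  \<open>l \<times> m\<close>; the excess weight over its centre is divided between the two
  strips.\<close>

lemma gdiff_square_le:
  assumes r: "even r" "8 \<le> r" "r + 8 \<le> l" "r + 8 \<le> m"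
    and k: "r\<^sup>2 + 4 \<le> 2 * k" "2 * k \<le> l * m"
  shows "gdiff r r (r\<^sup>2 div 2) \<le> gdiff l m k"
proof -
  obtain x y where xy: "l = r + x" "8 \<le> x" "m = r + y" "8 \<le> y"
    using r(3,4) by (metis add.commute add_le_imp_le_left le_Suc_ex le_add1 nat_le_iff_add add.assoc)
  obtain h where h: "r = 2 * h" using r(1) by (rule evenE)
  define k0 where "k0 = r\<^sup>2 div 2"
  have k0: "2 * k0 = r * r" by (simp add: k0_def h power2_eq_square)
  \<comment> \<open>The slack 4 in the hypothesis makes \<open>d\<close> at least 2.\<close>
  obtain d where d: "k = k0 + d" "d \<noteq> 1"
    using k(1) k0 by (intro that[of "k - k0"]) (auto simp: power2_eq_square)
  have "8 * 8 \<le> x * r" using xy r by (intro mult_le_mono) auto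
  then have "3 \<le> x * h" unfolding h by linarith
  from split_weight[OF d(2) this]
  obtain a b where ab: "d = a + b" "a \<le> x * h" "a \<noteq> 1" "b \<noteq> 1" "b \<le> max 2 (d - x * h)" .
  have "2 * a \<le> x * r" using ab(2) by (simp add: h)
  then have 1: "gdiff r r k0 \<le> gdiff l r (k0 + a)"
    using gdiff_mono_rectangle[of x r k0 r a] xy r k0 ab(3) by simp
  have "2 * 2 \<le> y * l" using xy by (intro mult_le_mono) auto
  \<comment> \<open>From l m = r^2 + x r + y l: the first strip takes weight up to
    \<open>x * h\<close>, half its area, and the rest fits into the second.\<close>
  moreover have "2 * (d - x * h) \<le> y * l"
    using k(2) d(1) k0 xy(1,3) by (simp add: h algebra_simps)
  ultimately have "2 * b \<le> y * l" using ab(5) by (auto simp: max_def split: if_splits)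
  moreover have "2 * (k0 + a) \<le> r * l" using k0 \<open>2 * a \<le> x * r\<close> xy(1) by (simp add: algebra_simps)
  ultimately have "gdiff r l (k0 + a) \<le> gdiff m l (k0 + a + b)"
    using gdiff_mono_rectangle[of y l "k0 + a" r b] xy ab(4) r by simp
  with 1 show ?thesis by (simp add: gdiff_commute[of l] d(1) ab(1) k0_def add.assoc)
qed

section \<open>The central difference of a square\<close>

lemma degree_gauss_poly: "degree (gauss_poly l m :: 'a::comm_semiring_1 poly) \<le> l * m"
proof (induction l m rule: gauss_poly.induct)
  case (3 l m)
  have "degree (monom 1 (Suc m) * gauss_poly l (Suc m) :: 'a poly) \<le> Suc m + l * Suc m"
    using degree_mult_le[of "monom 1 (Suc m) :: 'a poly" "gauss_poly l (Suc m)"]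
      degree_monom_le[of "1 :: 'a" "Suc m"] 3(2) by linarith
  then show ?case using 3(1) by (auto intro!: degree_add_le)
qed auto

section \<open>The q-binomial theorem\<close>

abbreviation gval :: "nat \<Rightarrow> nat \<Rightarrow> complex \<Rightarrow> complex" where
  "gval l m z \<equiv> poly (gauss_poly l m) z"

text \<open>The finite q-Pochhammer product (-X; z)_n, as a polynomial in X.\<close>

definition qpoch :: "nat \<Rightarrow> complex \<Rightarrow> complex poly" where
  "qpoch n z = (\<Prod>i<n. [:1, z ^ i:])"

lemma degree_qpoch: "degree (qpoch n z) \<le> n"
proof (induction n)
  case (Suc n)
  have "degree (qpoch (Suc n) z) \<le> degree (qpoch n z) + degree [:1, z ^ n:]"
    unfolding qpoch_def prod.lessThan_Suc by (rule degree_mult_le)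
  also have "\<dots> \<le> Suc n" using Suc degree_pCons_le[of 1 "[:z ^ n:]"] by simp
  finally show ?case .
qed (simp add: qpoch_def)

text \<open>Compares coefficients in the recursion for \<open>qpoch (Suc n) z\<close>, which is the
  q-Pascal rule up to the triangular power of z. The top coefficient is separate, because there the
  index \<open>Suc i\<close> exceeds \<open>n\<close>.\<close>

lemma coeff_qpoch: "j \<le> n \<Longrightarrow> coeff (qpoch n z) j = z ^ (j * (j - 1) div 2) * gval j (n - j) z"
proof (induction n arbitrary: j)
  case 0
  then show ?case by (simp add: qpoch_def)
next
  case (Suc n)
  have S: "qpoch (Suc n) z = qpoch n z + smult (z ^ n) (pCons 0 (qpoch n z))"
    by (simp add: qpoch_def)
  show ?case
  proof (cases j)
    case 0
    then show ?thesis using Suc.IH[of 0] by (simp add: S)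
  next
    case (Suc i)
    have e: "Suc i * i div 2 = i * (i - 1) div 2 + i"
    proof (cases i)
      case (Suc h)
      have "Suc i * i = i * (i - 1) + 2 * i" by (simp add: Suc algebra_simps)
      then show ?thesis by simp
    qed simp
    have i: "i \<le> n" using Suc Suc.prems by simp
    show ?thesis
    proof (cases "i = n")
      case True
      have "coeff (qpoch n z) (Suc n) = 0"
        using degree_qpoch[of n z] by (simp add: coeff_eq_0)
      then show ?thesis using Suc.IH[of n] True Suc e by (simp add: S power_add)
    next
      case False
      then obtain m where m: "n = Suc (i + m)" using i by (metis less_imp_Suc_add le_neq_implies_less)
      have "coeff (qpoch (Suc n) z) j = coeff (qpoch n z) (Suc i) + z ^ n * coeff (qpoch n z) i"
        by (simp add: S Suc)
      also have "\<dots> = z ^ (Suc i * i div 2) * gval (Suc i) m z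
          + z ^ n * (z ^ (i * (i - 1) div 2) * gval i (Suc m) z)"
        using Suc.IH[of "Suc i"] Suc.IH[of i] m by (simp add: Suc_diff_le)
      also have "\<dots> = z ^ (Suc i * i div 2) * (gval (Suc i) m z + z ^ Suc m * gval i (Suc m) z)"
        unfolding e m by (simp add: power_add algebra_simps)
      also have "gval (Suc i) m z + z ^ Suc m * gval i (Suc m) z = gval (Suc i) (Suc m) z"
        by (simp add: poly_monom)
      finally show ?thesis using Suc m by simp
    qed
  qed
qed

section \<open>Decay of the Gaussian polynomial away from z = 1\<close>

lemma has_integral_cis:
  fixes k :: int
  shows "((\<lambda>t. cis (k * t)) has_integral (if k = 0 then of_real (2 * pi) else 0)) {0..2 * pi}"
proof (cases "k = 0")
  case True
  then show ?thesis using has_integral_const_real[of "1 :: complex" 0 "2 * pi"] by (simp add: scaleR_conv_of_real)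
next
  case False
  have "((\<lambda>t. cis (k * t)) has_integral (cis (k * (2 * pi)) / (\<i> * k) - cis (real_of_int k * 0) / (\<i> * k))) {0..2 * pi}"
  proof (rule fundamental_theorem_of_calculus)
    fix t :: real
    show "((\<lambda>t. cis (k * t) / (\<i> * k)) has_vector_derivative cis (k * t)) (at t within {0..2 * pi})"
      unfolding has_vector_derivative_def using False
      by (auto intro!: derivative_eq_intros simp: scaleR_conv_of_real field_simps)
  qed simp
  then show ?thesis using False cis_multiple_2pi[of "of_int k"] by (simp add: mult_ac)
qed

text \<open>Cauchy's coefficient estimate on the unit circle, by orthogonality of the
  characters.\<close>

lemma norm_coeff_le_circle:
  assumes "\<And>t. norm (poly p (cis t)) \<le> B"
  shows "norm (coeff p n) \<le> B"
proof -
  have "((\<lambda>t. \<Sum>j\<le>degree p. coeff p j * cis (of_int (int j - int n) * t)) has_integral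
      (\<Sum>j\<le>degree p. coeff p j * (if int j - int n = 0 then of_real (2 * pi) else 0))) {0..2 * pi}"
    by (intro has_integral_sum has_integral_mult_right has_integral_cis) auto
  also have "(\<Sum>j\<le>degree p. coeff p j * (if int j - int n = 0 then of_real (2 * pi) else 0)) = coeff p n * of_real (2 * pi)"
    by (auto simp: if_distrib[of "\<lambda>x. _ * x"] coeff_eq_0 cong: if_cong)
  also have "(\<lambda>t. \<Sum>j\<le>degree p. coeff p j * cis (of_int (int j - int n) * t)) = (\<lambda>t. poly p (cis t) * cis (- (real n * t)))"
    by (rule ext) (simp add: poly_altdef sum_distrib_right Complex.DeMoivre cis_mult mult.assoc left_diff_distrib)
  finally have I: "((\<lambda>t. poly p (cis t) * cis (- (real n * t))) has_integral coeff p n * of_real (2 * pi)) {0..2 * pi}" .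
  have "norm (coeff p n * of_real (2 * pi)) \<le> B * Henstock_Kurzweil_Integration.content {0..2 * pi}"
    using assms order_trans[OF norm_ge_zero assms]
    by (intro has_integral_bound_real[OF _ _ I, of _ "{}"]) (auto simp: norm_mult)
  then show ?thesis by (simp add: norm_mult)
qed

lemma sin_ge_x_cos:
  fixes x :: real assumes "0 \<le> x" "x \<le> pi"
  shows "x * cos x \<le> sin x"
proof -
  have "(sin 0 - 0 * cos 0 :: real) \<le> sin x - x * cos x"
  proof (rule DERIV_nonneg_imp_nondecreasing[OF assms(1)])
    fix t assume t: "0 \<le> t" "t \<le> x"
    have "((\<lambda>t. sin t - t * cos t) has_real_derivative t * sin t) (at t)"
      by (auto intro!: derivative_eq_intros)
    then show "\<exists>y. ((\<lambda>t. sin t - t * cos t) has_real_derivative y) (at t) \<and> 0 \<le> y"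
      using t assms by (intro exI[of _ "t * sin t"]) (auto intro!: mult_nonneg_nonneg sin_ge_zero)
  qed
  then show ?thesis by simp
qed

lemma sin_ge_half:
  fixes x :: real assumes "0 \<le> x" "x \<le> pi / 3"
  shows "x / 2 \<le> sin x"
proof -
  have "cos (pi / 3) \<le> cos x" using assms by (intro cos_monotone_0_pi_le) auto
  then have "x * (1 / 2) \<le> x * cos x" using assms by (intro mult_left_mono) (auto simp: cos_60)
  then show ?thesis using sin_ge_x_cos[of x] assms by simp
qed

lemma norm_one_minus_cis: "norm (1 - cis t) = 2 * \<bar>sin (t / 2)\<bar>"
proof (rule power2_eq_imp_eq)
  have "(norm (1 - cis t))\<^sup>2 = 2 - 2 * cos t"
    using sin_cos_squared_add[of t] unfolding cmod_power2 by (simp add: power2_eq_square algebra_simps)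
  also have "cos t = 1 - 2 * (sin (t / 2))\<^sup>2" using cos_double_sin[of "t / 2"] by simp
  finally show "(norm (1 - cis t))\<^sup>2 = (2 * \<bar>sin (t / 2)\<bar>)\<^sup>2" by (simp add: power_mult_distrib)
qed auto

text \<open>The real part of a geometric sum, whose norm is at most 2 / |1 - cis x| however many
  terms it has.\<close>

lemma sum_cos_le:
  fixes t x :: real
  assumes "sin (x / 2) > 0"
  shows "(\<Sum>i<n. cos (t + real i * x)) \<le> 1 / sin (x / 2)"
proof -
  have "(\<Sum>i<n. cos (t + real i * x)) = Re (\<Sum>i<n. cis (t + real i * x))" by simp
  also have "\<dots> \<le> norm (\<Sum>i<n. cis (t + real i * x))" by (rule complex_Re_le_cmod)
  also have "(\<Sum>i<n. cis (t + real i * x)) = cis t * (\<Sum>i<n. cis x ^ i)"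
    by (simp add: Complex.DeMoivre cis_mult sum_distrib_left)
  also have "norm \<dots> = norm (\<Sum>i<n. cis x ^ i)" by (simp add: norm_mult)
  also have "\<dots> \<le> 2 / norm (1 - cis x)"
  proof -
    have 1: "norm (1 - cis x) > 0" using assms by (simp add: norm_one_minus_cis)
    have "norm ((1 - cis x) * (\<Sum>i<n. cis x ^ i)) = norm (1 - cis x ^ n)"
      by (simp add: one_diff_power_eq)
    also have "\<dots> \<le> norm (1 :: complex) + norm (cis x ^ n)" by (rule norm_triangle_ineq4)
    also have "\<dots> = 2" by (simp add: norm_power)
    finally show ?thesis using 1 unfolding norm_mult by (simp add: field_simps)
  qed
  finally show ?thesis using assms by (simp add: norm_one_minus_cis)
qed

text \<open>A squared factor is 4 (1 - (1 - cos a) / 2), which 1 + u \<le> exp u turns into an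
  exponential; the cosines collected in the exponent are bounded by
  \<open>sum_cos_le\<close>.\<close>

lemma norm_qpoch_le:
  fixes n :: nat and x t :: real
  assumes "sin (x / 2) > 0"
  shows "norm (poly (qpoch n (cis x)) (cis t)) \<le> 2 ^ n * exp (- (real n / 4) + 1 / (4 * sin (x / 2)))"
proof -
  have 1: "(norm (1 + cis a))\<^sup>2 \<le> 4 * exp (- (1 - cos a) / 2)" for a
  proof -
    have "(norm (1 + cis a))\<^sup>2 = 2 + 2 * cos a"
      using sin_cos_squared_add[of a] unfolding cmod_power2 by (simp add: power2_eq_square algebra_simps)
    also have "\<dots> \<le> 4 * exp (- (1 - cos a) / 2)"
      using exp_ge_add_one_self[of "- (1 - cos a) / 2"] by (simp add: field_simps)
    finally show ?thesis .
  qed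
  have "(norm (poly (qpoch n (cis x)) (cis t)))\<^sup>2 = (\<Prod>i<n. (norm (1 + cis (t + real i * x)))\<^sup>2)"
    by (simp add: qpoch_def poly_prod prod_norm[symmetric] prod_power_distrib Complex.DeMoivre cis_mult)
  also have "\<dots> \<le> (\<Prod>i<n. 4 * exp (- (1 - cos (t + real i * x)) / 2))"
    by (intro prod_mono) (use 1 in auto)
  also have "\<dots> = 4 ^ n * exp (- (real n / 2) + (\<Sum>i<n. cos (t + real i * x)) / 2)"
    by (simp add: prod.distrib exp_sum[symmetric] sum_divide_distrib[symmetric] sum_subtractf field_simps)
  also have "\<dots> \<le> 4 ^ n * exp (- (real n / 2) + 1 / sin (x / 2) / 2)"
    using sum_cos_le[OF assms, where n = n and t = t] by simp
  also have "\<dots> = (2 ^ n * exp (- (real n / 4) + 1 / (4 * sin (x / 2))))\<^sup>2"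
  proof -
    have "(4 :: real) ^ n = (2 ^ n)\<^sup>2" by (simp add: power2_eq_square flip: power_mult_distrib)
    moreover have "- (real n / 2) + 1 / sin (x / 2) / 2 =
        (- (real n / 4) + 1 / (4 * sin (x / 2))) + (- (real n / 4) + 1 / (4 * sin (x / 2)))" by simp
    then have "exp (- (real n / 2) + 1 / sin (x / 2) / 2) = (exp (- (real n / 4) + 1 / (4 * sin (x / 2))))\<^sup>2"
      by (simp only: power2_eq_square exp_add[symmetric])
    ultimately show ?thesis by (simp only: power_mult_distrib)
  qed
  finally show ?thesis by (rule power2_le_imp_le) simp
qed

lemma norm_gval_far:
  assumes "2 \<le> r" "pi / real r \<le> x" "x \<le> pi"
  shows "norm (gval r r (cis x)) \<le> 4 ^ r * exp (- (real r / 6))"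
proof -
  have y: "pi / (2 * real r) \<le> pi / 3" using assms(1) by (intro divide_left_mono) auto
  have "3 / (4 * real r) \<le> pi / (2 * real r) / 2"
    using pi_gt3 assms(1) by (simp add: field_simps)
  also have "\<dots> \<le> sin (pi / (2 * real r))" using y by (intro sin_ge_half) auto
  also have "\<dots> \<le> sin (x / 2)" 
  proof (rule sin_monotone_2pi_le)
    have "0 \<le> pi / (2 * real r)" by simp
    then show "- (pi / 2) \<le> pi / (2 * real r)" using pi_gt_zero by linarith
  qed (use assms in \<open>auto simp: field_simps\<close>)
  \<comment> \<open>This makes the correction term at most r / 3 in the exponent; with
    \<open>n = 2 * r\<close> the main term is - r / 2, whence - r / 6.\<close>
  finally have s: "3 / (4 * real r) \<le> sin (x / 2)" .
  moreover have "3 / (4 * real r) > 0" using assms(1) by simp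
  ultimately have s0: "sin (x / 2) > 0" by linarith
  have inv: "1 / (4 * sin (x / 2)) \<le> real r / 3"
    using s s0 assms(1) by (simp add: field_simps)
  have "norm (coeff (qpoch (2 * r) (cis x)) r) \<le> 2 ^ (2 * r) * exp (- (real (2 * r) / 4) + 1 / (4 * sin (x / 2)))"
    by (intro norm_coeff_le_circle norm_qpoch_le s0)
  also have "\<dots> \<le> 4 ^ r * exp (- (real r / 6))"
    unfolding power_mult using inv by (simp add: field_simps)
  finally show ?thesis
    by (simp add: coeff_qpoch norm_mult norm_power)
qed

section \<open>The Gaussian polynomial near z = 1\<close>

lemma gval_sin_product:
  "gval l m (cis (2 * y)) * (\<Prod>i=1..l. of_real (sin (real i * y))) =
     cis (real (l * m) * y) * (\<Prod>i=1..l. of_real (sin (real (m + i) * y)))"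
proof -
  have c: "cis (2 * y) ^ i - 1 = (2 * \<i> * cis (real i * y)) * of_real (sin (real i * y))" for i
  proof -
    have "cis (2 * y) ^ i = cis (real i * y) * cis (real i * y)"
      by (simp add: Complex.DeMoivre cis_mult mult_ac)
    moreover have "1 = cis (real i * y) * cis (- (real i * y))" by (simp add: cis_mult)
    ultimately have "cis (2 * y) ^ i - 1 = cis (real i * y) * (cis (real i * y) - cis (- (real i * y)))"
      by (simp only: right_diff_distrib)
    also have "cis a - cis (- a) = 2 * \<i> * of_real (sin a)" for a
      by (simp add: complex_eq_iff)
    finally show ?thesis by (simp add: mult_ac)
  qed
  let ?P = "\<Prod>i=1..l. 2 * \<i> * cis (real i * y)"
  have P: "?P \<noteq> 0" by (simp add: prod_zero_iff)
  have "gval l m (cis (2 * y)) * (\<Prod>i=1..l. cis (2 * y) ^ i - 1) = (\<Prod>i=1..l. cis (2 * y) ^ (m + i) - 1)"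
    using arg_cong[OF gauss_poly_product[of l m, where 'a = complex], of "\<lambda>p. poly p (cis (2 * y))"]
    by (simp add: poly_prod poly_monom)
  then have "gval l m (cis (2 * y)) * (\<Prod>i=1..l. of_real (sin (real i * y))) * ?P =
      (\<Prod>i=1..l. 2 * \<i> * cis (real (m + i) * y)) * (\<Prod>i=1..l. of_real (sin (real (m + i) * y)))"
    unfolding c by (simp only: prod.distrib mult_ac)
  \<comment> \<open>The shift by m contributes the phase \<open>cis (real m * y)\<close> to each of
    the l factors; what remains is the nonzero \<open>?P\<close>, which cancels.\<close>
  also have "(\<Prod>i=1..l. 2 * \<i> * cis (real (m + i) * y)) = (\<Prod>i=1..l. cis (real m * y) * (2 * \<i> * cis (real i * y)))"
    by (intro prod.cong refl) (simp add: cis_mult algebra_simps)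
  also have "\<dots> = cis (real (l * m) * y) * ?P"
    unfolding prod.distrib by (simp add: Complex.DeMoivre mult_ac)
  finally show ?thesis using P by (simp add: mult_ac)
qed

lemma gval_1: "gval l m 1 = of_nat ((l + m) choose l)"
proof (induction l m rule: gauss_poly.induct)
  case (3 l m)
  then show ?case by (simp add: poly_monom add.commute)
qed auto

text \<open>All half-angles i x / 2 with i \<le> l + m lie in [0, pi], so the sine quotient is
  nonnegative. Its denominator is positive because i \<le> l < l + m there.\<close>

lemma gval_centred_near:
  assumes "0 \<le> x" "real (l + m) * x \<le> 2 * pi"
  obtains R where "R \<ge> 0" "cis (- (real (l * m) * x / 2)) * gval l m (cis x) = of_real R"
proof (cases "x = 0 \<or> l = 0 \<or> m = 0")
  case True
  then show ?thesis
    using that[of "real ((l + m) choose l)"] that[of 1] by (auto simp: gval_1)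
next
  case False
  then have pos: "x > 0" "l > 0" "m > 0" using assms(1) by auto
  let ?y = "x / 2"
  define a b where "a = (\<Prod>i=1..l. sin (real i * ?y))" and "b = (\<Prod>i=1..l. sin (real (m + i) * ?y))"
  have sin: "0 \<le> sin (real i * ?y)" if "i \<le> l + m" for i
  proof (rule sin_ge_zero)
    have "real i * x \<le> real (l + m) * x" using that pos by (intro mult_right_mono) auto
    then show "real i * ?y \<le> pi" using assms(2) by simp
  qed (use pos in auto)
  have sin': "0 < sin (real i * ?y)" if "1 \<le> i" "i \<le> l" for i
  proof (rule sin_gt_zero)
    have "real i * x < real (l + m) * x" using that pos by (intro mult_strict_right_mono) auto
    then show "real i * ?y < pi" using assms(2) by simp
  qed (use pos that in auto)
  have a: "a > 0" unfolding a_def using sin' by (intro prod_pos) auto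
  have b: "b \<ge> 0" unfolding b_def using sin[of "m + _"] by (intro prod_nonneg) auto
  have "gval l m (cis x) * of_real a = cis (real (l * m) * x / 2) * of_real b"
    using gval_sin_product[of l m ?y] by (simp add: a_def b_def)
  then have "gval l m (cis x) = cis (real (l * m) * x / 2) * of_real (b / a)"
    using a by (simp add: field_simps)
  then have "cis (- (real (l * m) * x / 2)) * gval l m (cis x) = of_real (b / a)"
    by (simp add: cis_mult mult.assoc[symmetric])
  then show ?thesis using a b by (intro that[of "b / a"]) auto
qed

lemma gval_expand: "gval l m z = (\<Sum>n\<le>l * m. of_nat (gcoeff l m n) * z ^ n)"
proof -
  have "gval l m z = (\<Sum>n\<le>l * m. coeff (gauss_poly l m) n * z ^ n)"
    unfolding poly_altdef
    by (intro sum.mono_neutral_left) (use degree_gauss_poly[of l m, where 'a = complex] in \<open>auto simp: coeff_eq_0\<close>)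
  then show ?thesis by (subst (asm) coeff_gauss_poly)
qed

section \<open>The Fourier integral of the central difference\<close>

lemma has_integral_cos_0_pi:
  fixes k :: int
  shows "((\<lambda>t. cos (k * t)) has_integral (if k = 0 then pi else 0)) {0..pi}"
proof (cases "k = 0")
  case True
  then show ?thesis using has_integral_const_real[of "1 :: real" 0 pi] by simp
next
  case False
  have "((\<lambda>t. cos (k * t)) has_integral (sin (k * pi) / k - sin (real_of_int k * 0) / k)) {0..pi}"
    by (rule fundamental_theorem_of_calculus)
       (use False in \<open>auto intro!: derivative_eq_intros simp flip: has_real_derivative_iff_has_vector_derivative\<close>)
  then show ?thesis using False by (simp add: mult.commute[of _ pi])
qed

text \<open>The factor 1 - cis x passes from coefficients to differences; orthogonality of the
  cosines then selects the coefficients c and c - 1.\<close>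

lemma gdiff_fourier:
  "((\<lambda>x. Re ((1 - cis x) * (cis (- (real c * x)) * gval l m (cis x)))) has_integral pi * gdiff l m c) {0..pi}"
proof -
  have e: "Re ((1 - cis x) * (cis (- (real c * x)) * gval l m (cis x))) =
    (\<Sum>n\<le>l * m. gcoeff l m n * (cos (of_int (int n - int c) * x) - cos (of_int (int n + 1 - int c) * x)))" for x
  proof -
    have "(1 - cis x) * (cis (- (real c * x)) * gval l m (cis x)) =
      (\<Sum>n\<le>l * m. of_real (gcoeff l m n) * (cis (of_int (int n - int c) * x) - cis (of_int (int n + 1 - int c) * x)))"
      unfolding gval_expand sum_distrib_left
    proof (intro sum.cong refl)
      fix n
      have "(1 - cis x) * (cis (- (real c * x)) * (of_nat (gcoeff l m n) * cis x ^ n)) =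
          of_real (gcoeff l m n) * (cis (- (real c * x)) * cis (real n * x) - cis x * (cis (- (real c * x)) * cis (real n * x)))"
        by (simp add: Complex.DeMoivre left_diff_distrib right_diff_distrib mult_ac)
      also have "cis (- (real c * x)) * cis (real n * x) = cis (of_int (int n - int c) * x)"
        by (simp add: cis_mult algebra_simps)
      also have "cis x * cis (of_int (int n - int c) * x) = cis (of_int (int n + 1 - int c) * x)"
        by (simp add: cis_mult algebra_simps)
      finally show "(1 - cis x) * (cis (- (real c * x)) * (of_nat (gcoeff l m n) * cis x ^ n)) =
          of_real (gcoeff l m n) * (cis (of_int (int n - int c) * x) - cis (of_int (int n + 1 - int c) * x))" .
    qed
    then show ?thesis by simp
  qed
  \<comment> \<open>Covers \<open>c\<close> beyond the degree, where the sums over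
    \<open>n \<le> l * m\<close> miss the selected index.\<close>
  have 0: "gcoeff l m n = 0" if "n > l * m" for n
    using that degree_gauss_poly[of l m, where 'a = nat] by (simp add: coeff_eq_0)
  have "((\<lambda>x. \<Sum>n\<le>l * m. gcoeff l m n * (cos (of_int (int n - int c) * x) - cos (of_int (int n + 1 - int c) * x)))
     has_integral (\<Sum>n\<le>l * m. gcoeff l m n * ((if int n - int c = 0 then pi else 0) - (if int n + 1 - int c = 0 then pi else 0)))) {0..pi}"
    by (intro has_integral_sum has_integral_mult_right has_integral_diff has_integral_cos_0_pi) auto
  also have "(\<Sum>n\<le>l * m. gcoeff l m n * ((if int n - int c = 0 then pi else 0) - (if int n + 1 - int c = 0 then pi else 0)))
      = (\<Sum>n\<le>l * m. if n = c then gcoeff l m n * pi else 0) - (\<Sum>n\<le>l * m. if Suc n = c then gcoeff l m n * pi else 0)"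
    unfolding sum_subtractf[symmetric] by (intro sum.cong refl) auto
  also have "\<dots> = pi * gdiff l m c"
    using 0 by (cases c) (auto simp: gdiff_def algebra_simps)
  finally show ?thesis unfolding e .
qed

text \<open>In this window all phases (n - c) x are at most 1/2 in absolute value, so every cosine
  is at least 1/2 and \<open>R\<close> is at least half the central binomial coefficient, hence 4^r
  / (4 r). The other factor is 1 - cos x = 2 sin(x/2)^2.\<close>

lemma gval_near_lower:
  fixes c r :: nat
  assumes r: "2 \<le> r" "2 * c = r\<^sup>2" and x: "1 / (2 * real r ^ 2) \<le> x" "x \<le> 1 / real r ^ 2"
  shows "Re ((1 - cis x) * (cis (- (real c * x)) * gval r r (cis x))) \<ge> 4 ^ r / (128 * real r ^ 5)"
proof -
  have c: "real c = real (r * r) / 2" using r(2) by (simp add: power2_eq_square flip: of_nat_mult)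
  have "0 < 1 / (2 * real r ^ 2)" using r(1) by simp
  then have x0: "x > 0" using x(1) by linarith
  have xr: "x * real r ^ 2 \<le> 1" using x(2) r(1) by (simp add: field_simps)
  have "1 * 1 \<le> real r * real r" using r(1) by (intro mult_mono) auto
  then have "x * 1 \<le> x * real r ^ 2" unfolding power2_eq_square using x0 by (intro mult_left_mono) auto
  then have x1: "x \<le> 1" using xr by simp
  have "real (r + r) * x \<le> 2 * pi"
  proof -
    have "real r * x \<le> real r * real r * x" using r(1) x0 by (intro mult_right_mono) auto
    then show ?thesis using xr pi_gt3 by (simp add: power2_eq_square mult_ac)
  qed
  then obtain R where R: "R \<ge> 0" "cis (- (real (r * r) * x / 2)) * gval r r (cis x) = of_real R"
    using gval_centred_near[of x r r] x0 by auto
  have R': "cis (- (real c * x)) * gval r r (cis x) = of_real R" using R(2) by (simp add: c)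
  have "R = Re (cis (- (real c * x)) * gval r r (cis x))" using R' by simp
  also have "\<dots> = (\<Sum>n\<le>r * r. gcoeff r r n * cos ((real n - real c) * x))"
    unfolding gval_expand sum_distrib_left Re_sum
  proof (intro sum.cong refl)
    fix n
    have "cis (- (real c * x)) * (of_nat (gcoeff r r n) * cis x ^ n) = of_real (gcoeff r r n) * (cis (- (real c * x)) * cis (real n * x))"
      by (simp add: Complex.DeMoivre mult_ac)
    also have "cis (- (real c * x)) * cis (real n * x) = cis ((real n - real c) * x)"
      by (simp add: cis_mult algebra_simps)
    finally have E: "cis (- (real c * x)) * (of_nat (gcoeff r r n) * cis x ^ n) =
      of_real (gcoeff r r n) * cis ((real n - real c) * x)" .
    show "Re (cis (- (real c * x)) * (of_nat (gcoeff r r n) * cis x ^ n)) = gcoeff r r n * cos ((real n - real c) * x)"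
      unfolding E by simp
  qed
  also have "\<dots> \<ge> (\<Sum>n\<le>r * r. gcoeff r r n * (1 / 2))"
  proof (intro sum_mono mult_left_mono)
    fix n assume "n \<in> {..r * r}"
    then have "real n \<le> real (r * r)" by (subst of_nat_le_iff) simp
    then have "\<bar>real n - real c\<bar> \<le> real (r * r) / 2" unfolding c by (auto simp: abs_if)
    then have "\<bar>(real n - real c) * x\<bar> \<le> real (r * r) / 2 * x"
      using x0 unfolding abs_mult by (intro mult_mono) auto
    also have "\<dots> \<le> pi / 3" using xr pi_gt3 by (simp add: power2_eq_square mult_ac)
    finally have "cos (pi / 3) \<le> cos \<bar>(real n - real c) * x\<bar>" by (intro cos_monotone_0_pi_le) auto
    then show "1 / 2 \<le> cos ((real n - real c) * x)" by (simp add: cos_60)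
  qed auto
  also have "(\<Sum>n\<le>r * r. gcoeff r r n * (1 / 2 :: real)) = real ((2 * r) choose r) / 2"
  proof -
    have "of_real (\<Sum>n\<le>r * r. real (gcoeff r r n)) = gval r r 1" unfolding gval_expand by simp
    also have "\<dots> = of_real (real ((2 * r) choose r))" by (simp add: gval_1 mult_2)
    finally have "(\<Sum>n\<le>r * r. real (gcoeff r r n)) = real ((2 * r) choose r)" by (simp only: of_real_eq_iff)
    then show ?thesis by (simp flip: sum_divide_distrib)
  qed
  finally have R_ge: "4 ^ r / (4 * real r) \<le> R"
    using central_binomial_lower_bound[of r] r(1) by simp
  have "1 / (32 * real r ^ 4) \<le> 1 - cos x"
  proof -
    have "1 / (8 * real r ^ 2) \<le> x / 2 / 2" using x(1) by simp
    also have "\<dots> \<le> sin (x / 2)" using x0 x1 pi_gt3 by (intro sin_ge_half) auto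
    finally have "(1 / (8 * real r ^ 2))\<^sup>2 \<le> (sin (x / 2))\<^sup>2" by (intro power_mono) auto
    then have "2 * (1 / (8 * real r ^ 2))\<^sup>2 \<le> 1 - cos x" using cos_double_sin[of "x / 2"] by simp
    then show ?thesis by (simp add: power_divide power_mult_distrib flip: power_mult)
  qed
  then have "1 / (32 * real r ^ 4) * (4 ^ r / (4 * real r)) \<le> (1 - cos x) * R"
    using R_ge by (intro mult_mono) auto
  moreover have "1 / (32 * real r ^ 4) * (4 ^ r / (4 * real r)) = 4 ^ r / (128 * real r ^ 5)"
    by (simp add: power_numeral_reduce)
  ultimately show ?thesis unfolding R' by simp
qed

lemma gdiff_centre_lower:
  fixes c r :: nat
  assumes r: "2 \<le> r" "2 * c = r\<^sup>2"
  shows "pi * gdiff r r c \<ge> 4 ^ r / (256 * real r ^ 7) - 2 * pi * (4 ^ r * exp (- (real r / 6)))"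
proof -
  let ?h = "\<lambda>x. Re ((1 - cis x) * (cis (- (real c * x)) * gval r r (cis x)))"
  let ?M = "2 * (4 ^ r * exp (- (real r / 6)))" and ?K = "4 ^ r / (128 * real r ^ 5)"
  let ?a = "1 / (2 * real r ^ 2)" and ?b = "1 / real r ^ 2"
  have c: "real c = real (r * r) / 2" using r(2) by (simp add: power2_eq_square flip: of_nat_mult)
  have "1 \<le> real r ^ 2" using r(1) by (intro one_le_power) auto
  moreover have "0 < 1 / (2 * D)" "1 / (2 * D) \<le> 1 / D" "1 / D \<le> 1" if "1 \<le> D" for D :: real
    using that by (auto simp: field_simps)
  ultimately have "0 < ?a" "?a \<le> ?b" "?b \<le> 1" by blast+
  then have ab: "0 < ?a" "?a \<le> ?b" "?b \<le> pi" using pi_gt3 by linarith+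
  \<comment> \<open>A step function below the integrand: the gain \<open>?K\<close> on the window,
    the loss \<open>?M\<close> everywhere. Up to pi / r the integrand is nonnegative; beyond,
    \<open>norm_gval_far\<close> applies, and the factor 2 bounds |1 - cis x|.\<close>
  have bound: "(if x \<in> {?a..?b} then ?K else 0) - ?M \<le> ?h x" if x: "x \<in> {0..pi}" for x
  proof (cases "x \<in> {?a..?b}")
    case True
    then have "?K \<le> ?h x" using gval_near_lower[OF r, of x] by simp
    moreover have "0 \<le> ?M" by simp
    ultimately have "?K - ?M \<le> ?h x" by linarith
    then show ?thesis using True by (simp only: if_True)
  next
    case False
    consider "x \<le> pi / real r" | "pi / real r \<le> x" by linarith
    then have "- ?M \<le> ?h x"
    proof cases
      case 1
      have "real (r + r) * x \<le> 2 * pi" using 1 r(1) by (simp add: field_simps)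
      then obtain R where "R \<ge> 0" "cis (- (real (r * r) * x / 2)) * gval r r (cis x) = of_real R"
        using gval_centred_near[of x r r] x by auto
      then have "?h x = (1 - cos x) * R" by (simp add: c)
      also have "\<dots> \<ge> 0" using \<open>R \<ge> 0\<close> by simp
      finally have "0 \<le> ?h x" .
      moreover have "0 \<le> ?M" by simp
      ultimately show ?thesis by linarith
    next
      case 2
      have "\<bar>?h x\<bar> \<le> norm ((1 - cis x) * (cis (- (real c * x)) * gval r r (cis x)))"
        by (rule abs_Re_le_cmod)
      also have "\<dots> = norm (1 - cis x) * norm (gval r r (cis x))" by (simp add: norm_mult)
      also have "\<dots> \<le> 2 * (4 ^ r * exp (- (real r / 6)))"
        using norm_gval_far[OF r(1) 2] x norm_triangle_ineq4[of 1 "cis x"] by (intro mult_mono) auto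
      finally show ?thesis by linarith
    qed
    then show ?thesis using False by (simp only: if_False diff_0)
  qed
  have "((\<lambda>x. if x \<in> {?a..?b} then ?K else 0) has_integral ?K * (?b - ?a)) {0..pi}"
    using has_integral_restrict[of "{?a..?b}" "{0..pi}" "\<lambda>x. ?K"] has_integral_const_real[of ?K ?a ?b] ab
    by (simp add: mult.commute)
  then have "((\<lambda>x. (if x \<in> {?a..?b} then ?K else 0) - ?M) has_integral ?K * (?b - ?a) - pi * ?M) {0..pi}"
    using has_integral_const_real[of ?M 0 pi] by (intro has_integral_diff) auto
  from has_integral_le[OF this gdiff_fourier bound]
  have "?K * (?b - ?a) - pi * ?M \<le> pi * gdiff r r c" .
  moreover have "?b - ?a = 1 / (2 * real r ^ 2)" using r(1) by (simp add: field_simps)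
  then have "?K * (?b - ?a) = 4 ^ r / (256 * real r ^ 7)" by (simp add: power_numeral_reduce)
  ultimately show ?thesis by simp
qed

text \<open>After division by 4^r, the power r^(-7) eventually dominates both exp (- r / 6) and
  2^(-r).\<close>

lemma gdiff_centre_exponential:
  "\<exists>r0. \<forall>r\<ge>r0. even r \<longrightarrow> 2 ^ r \<le> gdiff r r (r\<^sup>2 div 2)"
proof -
  have "\<forall>\<^sub>F r :: nat in sequentially.
      pi * 2 ^ r \<le> 4 ^ r / (256 * real r ^ 7) - 2 * pi * (4 ^ r * exp (- (real r / 6)))"
    by real_asymp
  then obtain r0 where r0: "\<And>r. r \<ge> r0 \<Longrightarrow> pi * 2 ^ r \<le> 4 ^ r / (256 * real r ^ 7) - 2 * pi * (4 ^ r * exp (- (real r / 6)))"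
    unfolding eventually_sequentially by blast
  have "2 ^ r \<le> gdiff r r (r\<^sup>2 div 2)" if "r \<ge> max r0 2" "even r" for r
  proof -
    have "2 * (r\<^sup>2 div 2) = r\<^sup>2" using that(2) by simp
    then have "pi * 2 ^ r \<le> pi * gdiff r r (r\<^sup>2 div 2)"
      using r0[of r] gdiff_centre_lower[of r "r\<^sup>2 div 2"] that(1) by linarith
    then have "(2 :: real) ^ r \<le> gdiff r r (r\<^sup>2 div 2)" by simp
    then show ?thesis by (metis of_int_le_iff of_int_numeral of_int_power)
  qed
  then show ?thesis by blast
qed

section \<open>The lower bound\<close>

text \<open>The real \<open>t\<close> stands for sqrt s. All rounding losses go into
  \<open>r0\<close>, and for \<open>t \<le> r0\<close> the claimed bound is at most 1, so positivity
  suffices.\<close>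

lemma gdiff_exponential:
  "\<exists>r0 :: nat. \<forall>t l m k. 8 \<le> l \<longrightarrow> 8 \<le> m \<longrightarrow> k \<noteq> 1 \<longrightarrow> 2 * k \<le> l * m \<longrightarrow>
    t \<le> real l \<longrightarrow> t \<le> real m \<longrightarrow> t\<^sup>2 \<le> 2 * real k \<longrightarrow> 2 powr (t - real r0) \<le> gdiff l m k"
proof -
  obtain r1 :: nat where r1: "\<And>r. r1 \<le> r \<Longrightarrow> even r \<Longrightarrow> 2 ^ r \<le> gdiff r r (r\<^sup>2 div 2)"
    using gdiff_centre_exponential by blast
  \<comment> \<open>For t > r0 the even integer chosen below exceeds t - 12, hence r1 + 8.\<close>
  define r0 where "r0 = r1 + 20"
  have "2 powr (t - real r0) \<le> gdiff l m k"
    if lm: "8 \<le> l" "8 \<le> m" "k \<noteq> 1" "2 * k \<le> l * m" and t: "t \<le> real l" "t \<le> real m" "t\<^sup>2 \<le> 2 * real k" for t l m k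
  proof (cases "t \<le> real r0")
    case True
    then have "2 powr (t - real r0) \<le> 2 powr 0" by (intro powr_mono) auto
    then show ?thesis using gdiff_pos[OF lm] by simp
  next
    case False
    \<comment> \<open>\<open>2 * q\<close> is the largest even integer up to t - 10. The gap 10
      leaves the 8 rows and columns that \<open>gdiff_square_le\<close> adds, and gives r^2 + 4
      \<le> t^2.\<close>
    define q where "q = nat \<lfloor>(t - 10) / 2\<rfloor>"
    have "real q = of_int \<lfloor>(t - 10) / 2\<rfloor>" using False by (simp add: q_def r0_def)
    then have q: "real q \<le> (t - 10) / 2" "(t - 10) / 2 < real q + 1" by linarith+
    define r where "r = 2 * q"
    have r: "real r \<le> t - 10" "t - 12 \<le> real r" using q by (simp_all add: r_def)
    have "r1 + 8 \<le> r" using r(2) False unfolding r0_def by linarith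
    have "real (r\<^sup>2 + 4) \<le> real (2 * k)"
    proof -
      have "real r * real r \<le> (t - 10) * (t - 10)" using r by (intro mult_mono) auto
      moreover have "(t - 10) * (t - 10) + 4 \<le> t\<^sup>2" using False by (simp add: r0_def power2_eq_square algebra_simps)
      ultimately show ?thesis using t(3) by (simp add: power2_eq_square)
    qed
    then have k: "r\<^sup>2 + 4 \<le> 2 * k" by (simp only: of_nat_le_iff)
    have "2 powr (t - real r0) \<le> 2 powr real r" using r(2) by (intro powr_mono) (auto simp: r0_def)
    also have "\<dots> = 2 ^ r" by (simp add: powr_realpow)
    also have "\<dots> \<le> gdiff r r (r\<^sup>2 div 2)"
    proof -
      have "2 ^ r \<le> gdiff r r (r\<^sup>2 div 2)" using r1[of r] \<open>r1 + 8 \<le> r\<close> by (simp add: r_def)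
      then have "real_of_int (2 ^ r) \<le> real_of_int (gdiff r r (r\<^sup>2 div 2))" by (simp only: of_int_le_iff)
      then show ?thesis by simp
    qed
    also have "\<dots> \<le> gdiff l m k"
      unfolding of_int_le_iff
    proof (rule gdiff_square_le[OF _ _ _ _ k lm(4)])
      show "even r" by (simp add: r_def)
      show "8 \<le> r" "r + 8 \<le> l" "r + 8 \<le> m" using \<open>r1 + 8 \<le> r\<close> r t by linarith+
    qed
    finally show ?thesis .
  qed
  then show ?thesis by blast
qed

theorem theorem1p3:
  shows "\<exists>A::real. A > 0 \<and>
    (\<forall>l m k :: nat. 8 \<le> l \<longrightarrow> l \<le> m \<longrightarrow> 2 \<le> k \<longrightarrow> real k \<le> real l * real m / 2 \<longrightarrow>
      (let s = min (2 * real k) ((real l)\<^sup>2) in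
        real_of_int (qbin_coeff k l m - qbin_coeff (k - 1) l m) > A * (2 powr sqrt s / s powr (9 / 4))))"
proof -
  obtain r0 :: nat where r0: "\<And>t l m k. 8 \<le> l \<Longrightarrow> 8 \<le> m \<Longrightarrow> k \<noteq> 1 \<Longrightarrow> 2 * k \<le> l * m \<Longrightarrow>
      t \<le> real l \<Longrightarrow> t \<le> real m \<Longrightarrow> t\<^sup>2 \<le> 2 * real k \<Longrightarrow> 2 powr (t - real r0) \<le> gdiff l m k"
    using gdiff_exponential by blast
  let ?A = "2 powr (- real r0)"
  have "?A * (2 powr sqrt s / s powr (9 / 4)) < qbin_coeff k l m - qbin_coeff (k - 1) l m"
    if lmk: "8 \<le> l" "l \<le> m" "2 \<le> k" "real k \<le> real l * real m / 2"
      and s: "s = min (2 * real k) ((real l)\<^sup>2)" for l m k :: nat and s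
  proof -
    have "8 * 8 \<le> real l * real l" using lmk(1) by (intro mult_mono) auto
    then have s4: "4 \<le> s" using lmk(3) by (simp add: s power2_eq_square)
    then have sq: "(sqrt s)\<^sup>2 = s" by simp
    have "sqrt s \<le> sqrt ((real l)\<^sup>2)" unfolding s by (rule real_sqrt_le_mono) simp
    then have sl: "sqrt s \<le> real l" by simp
    have "real (2 * k) \<le> real (l * m)" using lmk(4) by simp
    then have "2 * k \<le> l * m" by (simp only: of_nat_le_iff)
    then have le: "2 powr (sqrt s - real r0) \<le> gdiff l m k"
      using lmk sl sq s by (intro r0) auto
    \<comment> \<open>The denominator exceeds 1 because \<open>s \<ge> 4\<close>; this makes the
      final inequality strict.\<close>
    have "1 powr (9 / 4) < s powr (9 / 4)" using s4 by (intro powr_less_mono2) auto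
    then have "2 powr sqrt s / s powr (9 / 4) < 2 powr sqrt s" by (simp add: divide_less_eq)
    then have "?A * (2 powr sqrt s / s powr (9 / 4)) < ?A * 2 powr sqrt s"
      by (intro mult_strict_left_mono) auto
    also have "\<dots> = 2 powr (sqrt s - real r0)" by (simp flip: powr_add)
    also note le
    also have "gdiff l m k = qbin_coeff k l m - qbin_coeff (k - 1) l m"
      using lmk(3) by (simp add: gdiff_def qbin_coeff_eq)
    finally show ?thesis .
  qed
  then show ?thesis by (intro exI[of _ ?A]) (auto simp: Let_def)
qed

end
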